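(* Let $\Gamma$ be a countable discrete group with sofic approximation $\sigma_i\colon\Gamma\to S_{d_i}$. Let $X$ be a compact metrizable space with $\Gamma\curvearrowright X$ by homeomorphisms, and let $k\in\mathbb{N}$. Then for any $1\le q\le\infty$, $$\mathrm{IE}^{\Lambda,k}_{(\sigma_i)_i}(q)\subseteq\mathrm{IE}^k_{(\sigma_i)_i}(q).$$
   Context: For $n\in\mathbb{N}$, $u_n$ is the uniform probability measure on $\{1,\dots,n\}$ and $S_n$ is the symmetric group. A sofic approximation of a countable discrete group $\Gamma$ is a sequence of functions (not assumed to be homomorphisms) $\sigma_i\colon\Gamma\to S_{d_i}$ such that $u_{d_i}(\{j:\sigma_i(gh)(j)=\sigma_i(g)\sigma_i(h)(j)\})\to 1$ for all $g,h\in\Gamma$ and $u_{d_i}(\{j:\sigma_i(g)(j)\ne j\})\to 1$ for all $g\in\Gamma\setminus\{e\}$. A continuous pseudometric $\rho$ on $X$ is dynamically generating if for all $x\ne y$ there is $g\in\Gamma$ with $\rho(gx,gy)>0$. For a finite set $A$ and $\phi,\psi\in X^A$, let $\rho_{q,A}(\phi,\psi)^q=\frac1{|A|}\sum_{a\in A}\rho(\phi(a),\psi(a))^q$ for $1\le q<\infty$ and $\rho_{\infty,A}(\phi,\psi)=\max_{a\in A}\rho(\phi(a),\psi(a))$ (interpreted as $0$ if $A=\varnothing$); $\rho_{q,d}$ means $\rho_{q,\{1,\dots,d\}}$. For finite $F\subseteq\Gamma$, $\delta>0$, $\mathrm{Map}(\rho,F,\delta,\sigma_i)$ is the set of $\phi\in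 X^{d_i}$ with $\max_{g\in F}\rho_{2,d_i}(\phi\circ\sigma_i(g),g\phi)<\delta$, where $(g\phi)(j)=g\phi(j)$. Let $x=(x_1,\dots,x_k)\in X^k$, $1\le q\le\infty$, $F,K\subseteq\Gamma$ finite, $\delta,\varepsilon>0$. A set $J\subseteq\{1,\dots,d_i\}$ is an $\ell^q$-$(\rho,F,\delta,\sigma_i;\varepsilon,K)$-independence set for $x$ if for every $c\colon J\to\{1,\dots,k\}$ there is $\phi\in\mathrm{Map}(\rho,F,\delta,\sigma_i)$ with $\max_{g\in K}\rho_{q,J}(g\phi(\cdot),gx_{c(\cdot)})<\varepsilon$. Let $I_q(x,\rho,F,\delta,\sigma_i;\varepsilon,K)$ be the maximum of $u_{d_i}(J)$ over such $J$ ($0$ if none), and $I_q(x,\rho,(\sigma_i)_i;\varepsilon,K)=\inf_{F,\delta}\limsup_i I_q(x,\rho,F,\delta,\sigma_i;\varepsilon,K)$. $\mathrm{IE}^k_{(\sigma_i)_i}(q)$ is the set of $x\in X^k$ with $I_q(x,\rho,(\sigma_i)_i;\varepsilon,K)>0$ for all $\varepsilon>0$ and finite $K\subseteq\Gamma$; it does not depend on the continuous dynamically generating pseudometric $\rho$. Write elements of $\mathbb{C}(\Gamma)$ as $\alpha=\sum_g\widehat\alpha(g)g$ and let $\lambda$ be the left regular representation of $\mathbb{C}(\Gamma)$ on $\ell^2(\Gamma)$. Let $\sigma_i(\alpha)=\sum_g\widehat\alpha(g)\sigma_i(g)\in M_{d_i}(\mathbb{C})$, with $\sigma_i(g)$ viewed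 as a permutation matrix, $(\sigma_i(g)\xi)(j)=\xi(\sigma_i(g)^{-1}(j))$. $\|\cdot\|_2$ on $\mathbb{C}^{d_i}$ is the norm of $\ell^2(d_i,u_{d_i})$. For finite $E\subseteq\mathbb{C}(\Gamma)$, $\eta>0$, $\Lambda(E,\eta,\sigma_i)$ is the set of $J\subseteq\{1,\dots,d_i\}$ with $\|\sigma_i(\alpha)(\chi_J-u_{d_i}(J)1)\|_2\le\|\lambda(\alpha)\|\,\|\chi_J-u_{d_i}(J)1\|_2+\eta$ for all $\alpha\in E$ ($\|\lambda(\alpha)\|$ the operator norm). $\Lambda_{(\sigma_i)_i}$ is the set of sequences $(J_i)_i$, $J_i\subseteq\{1,\dots,d_i\}$, such that for all finite $E\subseteq\mathbb{C}(\Gamma)$ and $\eta>0$, $J_i\in\Lambda(E,\eta,\sigma_i)$ for all large $i$. For $E\subseteq\mathbb{C}(\Gamma)$ finite and $\eta>0$, a $\Lambda$-$\ell^q$-$(\rho,F,\delta,E,\eta;\varepsilon,K)$-independence sequence for $x$ is a sequence $(J_i)_i\in\Lambda_{(\sigma_i)_i}$ such that for all sufficiently large $i$ and every $c\colon J_i\to\{1,\dots,k\}$ with $c^{-1}(\{l\})\in\Lambda(E,\eta,\sigma_i)$ for $1\le l\le k$ there is $\phi\in\mathrm{Map}(\rho,F,\delta,\sigma_i)$ with $\max_{g\in K}\rho_{q,J_i}(g\phi(\cdot),gx_{c(\cdot)})<\varepsilon$. Let $I_{\Lambda,q}(x,\rho,F,\delta,E,\eta,(\sigma_i)_i;\varepsilon,K)$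 be the supremum of $\limsup_i u_{d_i}(J_i)$ over such sequences ($0$ if none), and $I_{\Lambda,q}(x,\rho,(\sigma_i)_i;\varepsilon,K)=\inf_{F,\delta}\sup_{E,\eta}I_{\Lambda,q}(x,\rho,F,\delta,E,\eta,(\sigma_i)_i;\varepsilon,K)$. $\mathrm{IE}^{\Lambda,k}_{(\sigma_i)_i}(q)$ is the set of $x\in X^k$ with $I_{\Lambda,q}(x,\rho,(\sigma_i)_i;\varepsilon,K)>0$ for all $\varepsilon>0$ and finite $K\subseteq\Gamma$ ($\ell^q$-independence tuples satisfying the weak containment condition); it does not depend on $\rho$. *)

theory Defs
  imports
    "HOL-Analysis.Analysis"
    "HOL-Algebra.Group_Action"
    "HOL-Library.Poly_Mapping"
begin

section \<open>Sofic approximations\<close>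

definition unif :: "nat \<Rightarrow> nat set \<Rightarrow> real" where
  "unif n J = measure (uniform_count_measure {1..n}) J"

text \<open>The symmetric group $S_n$ is represented by the functions \<open>s\<close> with \<open>s permutes {1..n}\<close>.\<close>

definition sofic_approximation ::
  "('g, 'm) monoid_scheme \<Rightarrow> (nat \<Rightarrow> nat) \<Rightarrow> (nat \<Rightarrow> 'g \<Rightarrow> nat \<Rightarrow> nat) \<Rightarrow> bool" where
  "sofic_approximation G d \<sigma> \<longleftrightarrow>
     (\<forall>i. 1 \<le> d i) \<and>
     (\<forall>i. \<forall>g\<in>carrier G. \<sigma> i g permutes {1..d i}) \<and>
     (\<forall>g\<in>carrier G. \<forall>h\<in>carrier G.
        (\<lambda>i. unif (d i) {j\<in>{1..d i}. \<sigma> i (g \<otimes>\<^bsub>G\<^esub> h) j = \<sigma> i g (\<sigma> i h j)}) \<longlonglongrightarrow> 1) \<and>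
     (\<forall>g\<in>carrier G - {\<one>\<^bsub>G\<^esub>}.
        (\<lambda>i. unif (d i) {j\<in>{1..d i}. \<sigma> i g j \<noteq> j}) \<longlonglongrightarrow> 1)"


section \<open>Pseudometrics on \<open>X\<close> and microstates\<close>

definition continuous_pseudometric :: "'x topology \<Rightarrow> ('x \<Rightarrow> 'x \<Rightarrow> real) \<Rightarrow> bool" where
  "continuous_pseudometric X \<rho> \<longleftrightarrow>
     (\<forall>x\<in>topspace X. \<rho> x x = 0) \<and>
     (\<forall>x\<in>topspace X. \<forall>y\<in>topspace X. 0 \<le> \<rho> x y \<and> \<rho> x y = \<rho> y x) \<and>
     (\<forall>x\<in>topspace X. \<forall>y\<in>topspace X. \<forall>z\<in>topspace X. \<rho> x z \<le> \<rho> x y + \<rho> y z) \<and>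
     continuous_map (prod_topology X X) euclideanreal (\<lambda>(x, y). \<rho> x y)"

definition dynamically_generating ::
  "('g, 'm) monoid_scheme \<Rightarrow> 'x topology \<Rightarrow> ('g \<Rightarrow> 'x \<Rightarrow> 'x) \<Rightarrow> ('x \<Rightarrow> 'x \<Rightarrow> real) \<Rightarrow> bool" where
  "dynamically_generating G X act \<rho> \<longleftrightarrow>
     (\<forall>x\<in>topspace X. \<forall>y\<in>topspace X. x \<noteq> y \<longrightarrow> (\<exists>g\<in>carrier G. 0 < \<rho> (act g x) (act g y)))"

text \<open>For \<open>A = {}\<close> and finite \<open>q\<close> the right-hand side is also \<open>0\<close>, since \<open>0 / 0 = 0\<close>.\<close>

definition rho_q :: "('x \<Rightarrow> 'x \<Rightarrow> real) \<Rightarrow> ereal \<Rightarrow> 'a set \<Rightarrow> ('a \<Rightarrow> 'x) \<Rightarrow> ('a \<Rightarrow> 'x) \<Rightarrow> real" where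
  "rho_q \<rho> q A \<phi> \<psi> =
     (if q = \<infinity> then (if A = {} then 0 else (MAX a\<in>A. \<rho> (\<phi> a) (\<psi> a)))
      else ((\<Sum>a\<in>A. \<rho> (\<phi> a) (\<psi> a) powr real_of_ereal q) / real (card A))
             powr (1 / real_of_ereal q))"

text \<open>Below, a bound on a maximum over a finite set \<open>F\<close> or \<open>K\<close> of group elements is written as
  a bounded quantifier. The arguments \<open>n\<close> and \<open>s\<close> stand for $d_i$ and $\sigma_i$.\<close>

definition Microstates ::
  "'x topology \<Rightarrow> ('g \<Rightarrow> 'x \<Rightarrow> 'x) \<Rightarrow> ('x \<Rightarrow> 'x \<Rightarrow> real) \<Rightarrow> 'g set \<Rightarrow> real \<Rightarrow>
   nat \<Rightarrow> ('g \<Rightarrow> nat \<Rightarrow> nat) \<Rightarrow> (nat \<Rightarrow> 'x) set" where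
  "Microstates X act \<rho> F \<delta> n s =
     {\<phi> \<in> {1..n} \<rightarrow>\<^sub>E topspace X.
        \<forall>g\<in>F. rho_q \<rho> 2 {1..n} (\<lambda>j. \<phi> (s g j)) (\<lambda>j. act g (\<phi> j)) < \<delta>}"


section \<open>Independence tuples\<close>

definition independence_set ::
  "'x topology \<Rightarrow> ('g \<Rightarrow> 'x \<Rightarrow> 'x) \<Rightarrow> ereal \<Rightarrow> nat \<Rightarrow> (nat \<Rightarrow> 'x) \<Rightarrow> ('x \<Rightarrow> 'x \<Rightarrow> real) \<Rightarrow>
   'g set \<Rightarrow> real \<Rightarrow> nat \<Rightarrow> ('g \<Rightarrow> nat \<Rightarrow> nat) \<Rightarrow> real \<Rightarrow> 'g set \<Rightarrow> nat set \<Rightarrow> bool" where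
  "independence_set X act q k x \<rho> F \<delta> n s \<epsilon> K J \<longleftrightarrow>
     J \<subseteq> {1..n} \<and>
     (\<forall>c \<in> J \<rightarrow>\<^sub>E {1..k}. \<exists>\<phi>\<in>Microstates X act \<rho> F \<delta> n s.
        \<forall>g\<in>K. rho_q \<rho> q J (\<lambda>j. act g (\<phi> j)) (\<lambda>j. act g (x (c j))) < \<epsilon>)"

text \<open>Since \<open>unif\<close> is nonnegative, inserting \<open>0\<close> only takes care of the case where there are no
  independence sets.\<close>

definition I_fin ::
  "'x topology \<Rightarrow> ('g \<Rightarrow> 'x \<Rightarrow> 'x) \<Rightarrow> ereal \<Rightarrow> nat \<Rightarrow> (nat \<Rightarrow> 'x) \<Rightarrow> ('x \<Rightarrow> 'x \<Rightarrow> real) \<Rightarrow>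
   'g set \<Rightarrow> real \<Rightarrow> nat \<Rightarrow> ('g \<Rightarrow> nat \<Rightarrow> nat) \<Rightarrow> real \<Rightarrow> 'g set \<Rightarrow> real" where
  "I_fin X act q k x \<rho> F \<delta> n s \<epsilon> K =
     Max (insert 0 {unif n J | J. independence_set X act q k x \<rho> F \<delta> n s \<epsilon> K J})"

definition I_sofic ::
  "('g, 'm) monoid_scheme \<Rightarrow> 'x topology \<Rightarrow> ('g \<Rightarrow> 'x \<Rightarrow> 'x) \<Rightarrow> (nat \<Rightarrow> nat) \<Rightarrow>
   (nat \<Rightarrow> 'g \<Rightarrow> nat \<Rightarrow> nat) \<Rightarrow> ereal \<Rightarrow> nat \<Rightarrow> (nat \<Rightarrow> 'x) \<Rightarrow> ('x \<Rightarrow> 'x \<Rightarrow> real) \<Rightarrow>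
   real \<Rightarrow> 'g set \<Rightarrow> ereal" where
  "I_sofic G X act d \<sigma> q k x \<rho> \<epsilon> K =
     (INF (F, \<delta>) \<in> {F. finite F \<and> F \<subseteq> carrier G} \<times> {0<..}.
        limsup (\<lambda>i. ereal (I_fin X act q k x \<rho> F \<delta> (d i) (\<sigma> i) \<epsilon> K)))"

definition IE ::
  "('g, 'm) monoid_scheme \<Rightarrow> 'x topology \<Rightarrow> ('g \<Rightarrow> 'x \<Rightarrow> 'x) \<Rightarrow> (nat \<Rightarrow> nat) \<Rightarrow>
   (nat \<Rightarrow> 'g \<Rightarrow> nat \<Rightarrow> nat) \<Rightarrow> ('x \<Rightarrow> 'x \<Rightarrow> real) \<Rightarrow> nat \<Rightarrow> ereal \<Rightarrow> (nat \<Rightarrow> 'x) set" where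
  "IE G X act d \<sigma> \<rho> k q =
     {x \<in> {1..k} \<rightarrow>\<^sub>E topspace X.
        \<forall>\<epsilon>>0. \<forall>K. finite K \<and> K \<subseteq> carrier G \<longrightarrow> 0 < I_sofic G X act d \<sigma> q k x \<rho> \<epsilon> K}"


section \<open>The left regular representation and the weak containment condition\<close>

text \<open>Elements of the group ring are the finitely supported functions \<open>\<alpha> :: 'g \<Rightarrow>\<^sub>0 complex\<close> whose
  support \<open>Poly_Mapping.keys \<alpha>\<close> lies in the group; \<open>Poly_Mapping.lookup \<alpha> g\<close> is the coefficient of
  \<open>g\<close>.\<close>

definition group_ring :: "('g, 'm) monoid_scheme \<Rightarrow> ('g \<Rightarrow>\<^sub>0 complex) set" where
  "group_ring G = {\<alpha>. Poly_Mapping.keys \<alpha> \<subseteq> carrier G}"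

definition ell2 :: "('g, 'm) monoid_scheme \<Rightarrow> ('g \<Rightarrow> complex) set" where
  "ell2 G = {\<xi>. (\<lambda>h. (cmod (\<xi> h))\<^sup>2) summable_on carrier G}"

definition ell2_norm :: "('g, 'm) monoid_scheme \<Rightarrow> ('g \<Rightarrow> complex) \<Rightarrow> real" where
  "ell2_norm G \<xi> = sqrt (\<Sum>\<^sub>\<infinity>h\<in>carrier G. (cmod (\<xi> h))\<^sup>2)"

definition left_reg ::
  "('g, 'm) monoid_scheme \<Rightarrow> ('g \<Rightarrow>\<^sub>0 complex) \<Rightarrow> ('g \<Rightarrow> complex) \<Rightarrow> 'g \<Rightarrow> complex" where
  "left_reg G \<alpha> \<xi> =
     (\<lambda>h. \<Sum>g\<in>Poly_Mapping.keys \<alpha>. Poly_Mapping.lookup \<alpha> g * \<xi> (inv\<^bsub>G\<^esub> g \<otimes>\<^bsub>G\<^esub> h))"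

definition left_reg_norm :: "('g, 'm) monoid_scheme \<Rightarrow> ('g \<Rightarrow>\<^sub>0 complex) \<Rightarrow> real" where
  "left_reg_norm G \<alpha> = (SUP \<xi>\<in>{\<xi> \<in> ell2 G. ell2_norm G \<xi> \<le> 1}. ell2_norm G (left_reg G \<alpha> \<xi>))"

definition sofic_op ::
  "('g \<Rightarrow> nat \<Rightarrow> nat) \<Rightarrow> ('g \<Rightarrow>\<^sub>0 complex) \<Rightarrow> (nat \<Rightarrow> complex) \<Rightarrow> nat \<Rightarrow> complex" where
  "sofic_op s \<alpha> \<xi> =
     (\<lambda>j. \<Sum>g\<in>Poly_Mapping.keys \<alpha>. Poly_Mapping.lookup \<alpha> g * \<xi> (inv_into UNIV (s g) j))"

definition unif_norm2 :: "nat \<Rightarrow> (nat \<Rightarrow> complex) \<Rightarrow> real" where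
  "unif_norm2 n \<xi> = sqrt ((\<Sum>j\<in>{1..n}. (cmod (\<xi> j))\<^sup>2) / real n)"

definition centered_indicator :: "nat \<Rightarrow> nat set \<Rightarrow> nat \<Rightarrow> complex" where
  "centered_indicator n J = (\<lambda>j. indicator J j - of_real (unif n J))"

definition Lambda_set ::
  "('g, 'm) monoid_scheme \<Rightarrow> ('g \<Rightarrow>\<^sub>0 complex) set \<Rightarrow> real \<Rightarrow> nat \<Rightarrow> ('g \<Rightarrow> nat \<Rightarrow> nat) \<Rightarrow>
   nat set set" where
  "Lambda_set G E \<eta> n s =
     {J. J \<subseteq> {1..n} \<and>
        (\<forall>\<alpha>\<in>E. unif_norm2 n (sofic_op s \<alpha> (centered_indicator n J))
                 \<le> left_reg_norm G \<alpha> * unif_norm2 n (centered_indicator n J) + \<eta>)}"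

definition Lambda_seq ::
  "('g, 'm) monoid_scheme \<Rightarrow> (nat \<Rightarrow> nat) \<Rightarrow> (nat \<Rightarrow> 'g \<Rightarrow> nat \<Rightarrow> nat) \<Rightarrow> (nat \<Rightarrow> nat set) set" where
  "Lambda_seq G d \<sigma> =
     {J. (\<forall>i. J i \<subseteq> {1..d i}) \<and>
        (\<forall>E. finite E \<and> E \<subseteq> group_ring G \<longrightarrow>
           (\<forall>\<eta>>0. \<forall>\<^sub>F i in sequentially. J i \<in> Lambda_set G E \<eta> (d i) (\<sigma> i)))}"

definition Lambda_independence_seq ::
  "('g, 'm) monoid_scheme \<Rightarrow> 'x topology \<Rightarrow> ('g \<Rightarrow> 'x \<Rightarrow> 'x) \<Rightarrow> (nat \<Rightarrow> nat) \<Rightarrow>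
   (nat \<Rightarrow> 'g \<Rightarrow> nat \<Rightarrow> nat) \<Rightarrow> ereal \<Rightarrow> nat \<Rightarrow> (nat \<Rightarrow> 'x) \<Rightarrow> ('x \<Rightarrow> 'x \<Rightarrow> real) \<Rightarrow>
   'g set \<Rightarrow> real \<Rightarrow> ('g \<Rightarrow>\<^sub>0 complex) set \<Rightarrow> real \<Rightarrow> real \<Rightarrow> 'g set \<Rightarrow> (nat \<Rightarrow> nat set) \<Rightarrow> bool" where
  "Lambda_independence_seq G X act d \<sigma> q k x \<rho> F \<delta> E \<eta> \<epsilon> K J \<longleftrightarrow>
     J \<in> Lambda_seq G d \<sigma> \<and>
     (\<forall>\<^sub>F i in sequentially.
        \<forall>c \<in> J i \<rightarrow>\<^sub>E {1..k}.
          (\<forall>l\<in>{1..k}. {j \<in> J i. c j = l} \<in> Lambda_set G E \<eta> (d i) (\<sigma> i)) \<longrightarrow>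
          (\<exists>\<phi>\<in>Microstates X act \<rho> F \<delta> (d i) (\<sigma> i).
             \<forall>g\<in>K. rho_q \<rho> q (J i) (\<lambda>j. act g (\<phi> j)) (\<lambda>j. act g (x (c j))) < \<epsilon>))"

definition I_Lambda_fin ::
  "('g, 'm) monoid_scheme \<Rightarrow> 'x topology \<Rightarrow> ('g \<Rightarrow> 'x \<Rightarrow> 'x) \<Rightarrow> (nat \<Rightarrow> nat) \<Rightarrow>
   (nat \<Rightarrow> 'g \<Rightarrow> nat \<Rightarrow> nat) \<Rightarrow> ereal \<Rightarrow> nat \<Rightarrow> (nat \<Rightarrow> 'x) \<Rightarrow> ('x \<Rightarrow> 'x \<Rightarrow> real) \<Rightarrow>
   'g set \<Rightarrow> real \<Rightarrow> ('g \<Rightarrow>\<^sub>0 complex) set \<Rightarrow> real \<Rightarrow> real \<Rightarrow> 'g set \<Rightarrow> ereal" where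
  "I_Lambda_fin G X act d \<sigma> q k x \<rho> F \<delta> E \<eta> \<epsilon> K =
     Sup (insert 0 {limsup (\<lambda>i. ereal (unif (d i) (J i))) | J.
                      Lambda_independence_seq G X act d \<sigma> q k x \<rho> F \<delta> E \<eta> \<epsilon> K J})"

definition I_Lambda ::
  "('g, 'm) monoid_scheme \<Rightarrow> 'x topology \<Rightarrow> ('g \<Rightarrow> 'x \<Rightarrow> 'x) \<Rightarrow> (nat \<Rightarrow> nat) \<Rightarrow>
   (nat \<Rightarrow> 'g \<Rightarrow> nat \<Rightarrow> nat) \<Rightarrow> ereal \<Rightarrow> nat \<Rightarrow> (nat \<Rightarrow> 'x) \<Rightarrow> ('x \<Rightarrow> 'x \<Rightarrow> real) \<Rightarrow>
   real \<Rightarrow> 'g set \<Rightarrow> ereal" where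
  "I_Lambda G X act d \<sigma> q k x \<rho> \<epsilon> K =
     (INF (F, \<delta>) \<in> {F. finite F \<and> F \<subseteq> carrier G} \<times> {0<..}.
        SUP (E, \<eta>) \<in> {E. finite E \<and> E \<subseteq> group_ring G} \<times> {0<..}.
          I_Lambda_fin G X act d \<sigma> q k x \<rho> F \<delta> E \<eta> \<epsilon> K)"

definition IE_Lambda ::
  "('g, 'm) monoid_scheme \<Rightarrow> 'x topology \<Rightarrow> ('g \<Rightarrow> 'x \<Rightarrow> 'x) \<Rightarrow> (nat \<Rightarrow> nat) \<Rightarrow>
   (nat \<Rightarrow> 'g \<Rightarrow> nat \<Rightarrow> nat) \<Rightarrow> ('x \<Rightarrow> 'x \<Rightarrow> real) \<Rightarrow> nat \<Rightarrow> ereal \<Rightarrow> (nat \<Rightarrow> 'x) set" where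
  "IE_Lambda G X act d \<sigma> \<rho> k q =
     {x \<in> {1..k} \<rightarrow>\<^sub>E topspace X.
        \<forall>\<epsilon>>0. \<forall>K. finite K \<and> K \<subseteq> carrier G \<longrightarrow> 0 < I_Lambda G X act d \<sigma> q k x \<rho> \<epsilon> K}"

end

theory Submission
  imports Defs
begin

text \<open>Let \<open>J\<close> be a large set satisfying the weak containment condition and colour \<open>J\<close> uniformly at
  random. The indicator of a colour class is \<open>1/k\<close> times that of \<open>J\<close> plus a noise term with
  independent centred coordinates. Second moments show that the noise is nearly orthogonal to its
  translates and to those of the indicator of \<open>J\<close>, so \<open>\<sigma>(\<alpha>)\<close> acts on it with norm about
  \<open>\<parallel>\<alpha>\<parallel>\<^sub>2 \<le> \<parallel>\<lambda>(\<alpha>)\<parallel>\<close>; hence at least half of all colourings have all their classes in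
  \<open>\<Lambda>(E, \<eta>)\<close> and are realised by microstates. By a Sauer-Shelah argument for \<open>k\<close> colours these
  colourings restrict to all colourings of some subset of \<open>J\<close> of proportional size, and passing
  to that subset only changes the \<open>\<ell>\<^sup>q\<close> distances by a constant factor.\<close>

section \<open>Shattered sets\<close>

text \<open>The hypothesis realises only colourings of J whose classes satisfy weak containment, so
  J itself need not be an independence set; a subset is wanted on which every pattern extends to a
  realised colouring. Weak containment survives the colouring because one number L =
  \<open>left_reg_norm G \<alpha>\<close> controls both parts of f = p v + z (p = 1/k, v the centred
  indicator of J, z the centred noise): near orthogonality, used both before and after applying
  \<sigma>(\<alpha>), gives |\<sigma>(\<alpha>) f|^2 ~ p^2 |\<sigma>(\<alpha>) v|^2 + |\<alpha>|_2^2
  |z|^2, at most about L^2 |f|^2. The obstacle is bounded degree. The proportion of bad colourings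
  is only bounded by a multiple of 1/d_i, and d_i need not tend to infinity when the group is
  finite. Counting colourings is therefore used only above a threshold for d_i; below it, every set
  satisfies weak containment for late i. Moreover the density of J i is bounded below only for
  infinitely many i, so statements about late i carry the density as a premise.\<close>

definition shatters :: "('a \<Rightarrow> 'b) set \<Rightarrow> 'a set \<Rightarrow> 'b set \<Rightarrow> bool" where
  "shatters S I B \<longleftrightarrow> (\<forall>c\<in>I \<rightarrow>\<^sub>E B. \<exists>s\<in>S. \<forall>i\<in>I. s i = c i)"

text \<open>The induction on \<open>J\<close> removes a point \<open>a\<close>: a set shattered by the union \<open>U\<close> of the slices of \<open>S\<close>
  over \<open>a\<close> is shattered by \<open>S\<close>, and a set shattered by their intersection \<open>T\<close> can be enlarged by \<open>a\<close>,
  so that \<open>T\<close> contributes with \<open>t - 1\<close> in place of \<open>t\<close>.\<close>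

lemma card_le_of_shatters:
  assumes "finite J" and "finite B" and "B \<noteq> {}" and "S \<subseteq> J \<rightarrow>\<^sub>E B"
    and "\<And>I. I \<subseteq> J \<Longrightarrow> shatters S I B \<Longrightarrow> card I \<le> t"
  shows "real (card S) \<le> 2 ^ t * (real (card B) - 1 / 2) ^ card J"
  using assms(1,4,5)
proof (induction J arbitrary: S t rule: finite_induct)
  case empty
  then have "card S \<le> card {(\<lambda>x. undefined) :: 'a \<Rightarrow> 'b}"
    by (intro card_mono) auto
  then have "real (card S) \<le> 1" by simp
  also have "1 \<le> (2::real) ^ t" by simp
  finally show ?case by simp
next
  case (insert a J)
  define slice where "slice y = {c \<in> J \<rightarrow>\<^sub>E B. c(a := y) \<in> S}" for y
  define U where "U = (\<Union>y\<in>B. slice y)"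
  define T where "T = {c \<in> U. \<forall>y\<in>B. c \<in> slice y}"
  have finP: "finite (J \<rightarrow>\<^sub>E B)"
    using insert.hyps(1) assms(2) by (simp add: finite_PiE)
  have U_sub: "U \<subseteq> J \<rightarrow>\<^sub>E B" and T_sub: "T \<subseteq> J \<rightarrow>\<^sub>E B"
    by (auto simp: U_def T_def slice_def)
  have finU: "finite U" and finT: "finite T"
    using finP U_sub T_sub finite_subset by blast+
  have fin_slice: "finite (slice y)" for y
    using finP by (simp add: slice_def)
  have k1: "1 \<le> real (card B)"
    using assms(2,3) by (simp add: Suc_leI card_gt_0_iff)
  have S_eq: "S \<subseteq> (\<Union>y\<in>B. (\<lambda>c. c(a := y)) ` slice y)"
  proof
    fix s assume s: "s \<in> S"
    with insert.prems(1) have "s \<in> insert a J \<rightarrow>\<^sub>E B" by blast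
    then obtain y c where "y \<in> B" "c \<in> J \<rightarrow>\<^sub>E B" "s = c(a := y)"
      by (auto simp: PiE_insert_eq)
    with s show "s \<in> (\<Union>y\<in>B. (\<lambda>c. c(a := y)) ` slice y)"
      by (auto simp: slice_def)
  qed
  have "card S \<le> card (\<Union>y\<in>B. (\<lambda>c. c(a := y)) ` slice y)"
    using S_eq assms(2) fin_slice by (intro card_mono) auto
  also have "\<dots> \<le> (\<Sum>y\<in>B. card ((\<lambda>c. c(a := y)) ` slice y))"
    by (rule card_UN_le[OF assms(2)])
  also have "\<dots> \<le> (\<Sum>y\<in>B. card (slice y))"
    by (intro sum_mono card_image_le fin_slice)
  also have "\<dots> = (\<Sum>y\<in>B. \<Sum>c\<in>U. if c \<in> slice y then 1 else 0)"
  proof (rule sum.cong)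
    fix y assume "y \<in> B"
    then have "U \<inter> slice y = slice y" by (auto simp: U_def)
    then show "card (slice y) = (\<Sum>c\<in>U. if c \<in> slice y then 1 else 0)"
      using finU by (simp add: sum.inter_restrict[symmetric])
  qed simp
  also have "\<dots> = (\<Sum>c\<in>U. \<Sum>y\<in>B. if c \<in> slice y then 1 else 0)"
    by (rule sum.swap)
  \<comment> \<open>Unless c lies in T, some colour at \<open>a\<close> is missing, so c has at most
    \<open>card B - 1\<close> extensions in S.\<close>
  also have "\<dots> \<le> (\<Sum>c\<in>U. (card B - 1) + (if c \<in> T then 1 else 0))"
  proof (rule sum_mono)
    fix c assume c: "c \<in> U"
    have "(\<Sum>y\<in>B. if c \<in> slice y then 1 else 0) = card {y \<in> B. c \<in> slice y}"
      using assms(2) by (simp add: sum.inter_filter[symmetric])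
    also have "\<dots> \<le> (card B - 1) + (if c \<in> T then 1 else 0)"
    proof (cases "c \<in> T")
      case True
      have "card {y \<in> B. c \<in> slice y} \<le> card B"
        using assms(2) by (intro card_mono) auto
      then show ?thesis using True by simp
    next
      case False
      then have "{y \<in> B. c \<in> slice y} \<subset> B"
        using c by (auto simp: T_def)
      then have "card {y \<in> B. c \<in> slice y} < card B"
        using assms(2) by (simp add: psubset_card_mono)
      then show ?thesis by simp
    qed
    finally show "(\<Sum>y\<in>B. if c \<in> slice y then 1 else 0)
      \<le> (card B - 1) + (if c \<in> T then 1 else 0)" .
  qed
  also have "\<dots> = card U * (card B - 1) + card T"
  proof -
    have "U \<inter> T = T" by (auto simp: T_def)
    then show ?thesis using finU by (simp add: sum.distrib sum.inter_restrict[symmetric])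
  qed
  finally have "real (card S) \<le> real (card U * (card B - 1) + card T)"
    by (rule of_nat_mono)
  also have "\<dots> = real (card U) * (real (card B) - 1) + real (card T)"
    using k1 by (simp add: of_nat_diff)
  finally have S_le: "real (card S) \<le> real (card U) * (real (card B) - 1) + real (card T)" .
  have sh_U: "card I \<le> t" if I: "I \<subseteq> J" "shatters U I B" for I
  proof (rule insert.prems(2))
    show "I \<subseteq> insert a J" using I by auto
    show "shatters S I B" unfolding shatters_def
    proof
      fix c assume "c \<in> I \<rightarrow>\<^sub>E B"
      then obtain u y where "y \<in> B" "u \<in> slice y" "\<forall>i\<in>I. u i = c i"
        using I(2) unfolding shatters_def U_def by blast
      moreover have "a \<notin> I" using I insert.hyps by auto
      ultimately show "\<exists>s\<in>S. \<forall>i\<in>I. s i = c i"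
        by (intro bexI[of _ "u(a := y)"]) (auto simp: slice_def)
    qed
  qed
  have sh_T: "Suc (card I) \<le> t" if I: "I \<subseteq> J" "shatters T I B" for I
  proof -
    have aI: "a \<notin> I" "finite I" using I insert.hyps finite_subset by auto
    have "shatters S (insert a I) B" unfolding shatters_def
    proof
      fix c assume c: "c \<in> insert a I \<rightarrow>\<^sub>E B"
      then have "restrict c I \<in> I \<rightarrow>\<^sub>E B" by auto
      then obtain s where s: "s \<in> T" "\<forall>i\<in>I. s i = restrict c I i"
        using I(2) unfolding shatters_def by blast
      have "c a \<in> B" using c by auto
      then have "s(a := c a) \<in> S" using s(1) by (auto simp: T_def slice_def)
      then show "\<exists>s\<in>S. \<forall>i\<in>insert a I. s i = c i"
        using s(2) aI by (intro bexI[of _ "s(a := c a)"]) auto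
    qed
    then have "card (insert a I) \<le> t" using I(1) by (intro insert.prems(2)) auto
    then show ?thesis using aI by simp
  qed
  let ?w = "(real (card B) - 1 / 2) ^ card J"
  have w0: "0 \<le> ?w" using k1 by simp
  have U_le: "real (card U) \<le> 2 ^ t * ?w"
    using insert.IH[OF U_sub] sh_U by blast
  have T_le: "real (card T) \<le> 2 ^ t * ?w / 2"
  proof (cases t)
    case 0
    \<comment> \<open>There is no t - 1 for the induction hypothesis here, but a nonempty T shatters
      the empty set, which would force 1 \<le> 0.\<close>
    have "T = {}"
    proof (rule ccontr)
      assume "T \<noteq> {}"
      then have "shatters T {} B" by (auto simp: shatters_def)
      then show False using sh_T[of "{}"] 0 by simp
    qed
    then show ?thesis using w0 by simp
  next
    case (Suc t')
    have "real (card T) \<le> 2 ^ t' * ?w"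
      using insert.IH[OF T_sub, of t'] sh_T Suc by simp
    then show ?thesis using Suc by simp
  qed
  \<comment> \<open>U enters with weight k - 1 and T with weight 1/2, as lowering t by one halves
    \<open>2 ^ t\<close>. The sum k - 1/2 is the base of the bound.\<close>
  have "real (card U) * (real (card B) - 1) \<le> 2 ^ t * ?w * (real (card B) - 1)"
    using U_le k1 by (intro mult_right_mono) auto
  with S_le T_le have "real (card S) \<le> 2 ^ t * ?w * (real (card B) - 1) + 2 ^ t * ?w / 2"
    by linarith
  also have "\<dots> = 2 ^ t * (real (card B) - 1 / 2) ^ card (insert a J)"
    using insert.hyps by (simp add: algebra_simps)
  finally show ?case .
qed

text \<open>At the largest size t of a shattered set, the preceding bound and \<open>half\<close>
  give \<beta> |J| \<le> t + 1 after taking logarithms. By \<open>big\<close> the extra 1 is at most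
  \<beta> |J| / 2, which is why only \<beta> / 2 survives.\<close>

lemma large_shattered_set:
  fixes J :: "'a set" and B :: "'b set"
  assumes "finite J" and "finite B" and "B \<noteq> {}" and "S \<subseteq> J \<rightarrow>\<^sub>E B"
    and half: "real (card (J \<rightarrow>\<^sub>E B)) \<le> 2 * real (card S)"
    and \<beta>: "\<beta> = log 2 (real (card B) / (real (card B) - 1 / 2))"
    and big: "2 \<le> \<beta> * real (card J)"
  shows "\<exists>I\<subseteq>J. shatters S I B \<and> \<beta> / 2 * real (card J) \<le> real (card I)"
proof -
  have k1: "1 \<le> real (card B)"
    using assms(2,3) by (simp add: Suc_leI card_gt_0_iff)
  have card_P: "real (card (J \<rightarrow>\<^sub>E B)) = real (card B) ^ card J"
    using assms(1) by (simp add: card_PiE)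
  then have "0 < real (card (J \<rightarrow>\<^sub>E B))" using k1 by simp
  then have "S \<noteq> {}" using half by auto
  then have sh0: "shatters S {} B" by (auto simp: shatters_def)
  define A where "A = card ` {I. I \<subseteq> J \<and> shatters S I B}"
  have A: "finite A" "A \<noteq> {}" using assms(1) sh0 by (auto simp: A_def)
  define t where "t = Max A"
  have "t \<in> A" using A by (simp add: t_def)
  then obtain I where I: "I \<subseteq> J" "shatters S I B" "t = card I" by (auto simp: A_def)
  have "card I' \<le> t" if "I' \<subseteq> J" "shatters S I' B" for I'
    using A(1) that by (auto simp: t_def A_def)
  then have "real (card S) \<le> 2 ^ t * (real (card B) - 1 / 2) ^ card J"
    by (rule card_le_of_shatters[OF assms(1-4)])
  then have "real (card B) ^ card J \<le> 2 ^ Suc t * (real (card B) - 1 / 2) ^ card J"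
    using half card_P by simp
  then have "(real (card B) / (real (card B) - 1 / 2)) ^ card J \<le> 2 ^ Suc t"
    using k1 by (simp add: power_divide divide_le_eq)
  then have "log 2 ((real (card B) / (real (card B) - 1 / 2)) ^ card J) \<le> log 2 (2 ^ Suc t)"
    using k1 by (subst log_le_cancel_iff) auto
  then have "real (card J) * \<beta> \<le> real (Suc t)"
    using k1 by (simp add: \<beta> log_nat_power del: power_Suc)
  then have "\<beta> / 2 * real (card J) \<le> real t" using big by (simp add: mult.commute)
  then show ?thesis using I by blast
qed

text \<open>The ratio k / (k - 1/2) lies in (1, 2], with value 2 at k = 1. The lower bound yields a
  positive proportion; the upper one lets all of J qualify as a shattered set of the required
  size.\<close>

lemma log_ratio_bounds:
  assumes "1 \<le> k" and "\<beta> = log 2 (real k / (real k - 1 / 2))"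
  shows "0 < \<beta>" and "\<beta> \<le> 1"
proof -
  have k: "1 \<le> real k" using assms(1) by simp
  then show "0 < \<beta>" by (simp add: assms(2) less_divide_eq)
  have "log 2 (real k / (real k - 1 / 2)) \<le> log 2 2"
    using k by (subst log_le_cancel_iff) (simp_all add: divide_le_eq)
  then show "\<beta> \<le> 1" by (simp add: assms(2))
qed

section \<open>Random colourings\<close>

text \<open>Chebyshev's inequality, phrased as counting: each index correlates only with members of
  \<open>N j\<close>, so the second moment of the sum is at most 2 n |\<Omega>|. Two members per
  index leave room for quadratic expressions in the noise, where two indices may involve the same
  pair of points.\<close>

lemma card_deviation_le:
  fixes X :: "nat \<Rightarrow> 'c \<Rightarrow> real"
  assumes fin: "finite \<Omega>" and "0 < n" and "0 < \<theta>"
    and bound: "\<And>j \<omega>. \<bar>X j \<omega>\<bar> \<le> 1"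
    and N: "\<And>j. j \<in> {1..n} \<Longrightarrow> finite (N j) \<and> card (N j) \<le> 2"
    and orth: "\<And>j j'. j \<in> {1..n} \<Longrightarrow> j' \<in> {1..n} \<Longrightarrow> j' \<notin> N j \<Longrightarrow> (\<Sum>\<omega>\<in>\<Omega>. X j \<omega> * X j' \<omega>) = 0"
  shows "real (card {\<omega>\<in>\<Omega>. \<theta> < \<bar>(\<Sum>j\<in>{1..n}. X j \<omega>) / real n\<bar>})
    \<le> 2 * real (card \<Omega>) / (real n * \<theta>\<^sup>2)"
proof -
  let ?Y = "\<lambda>\<omega>. \<Sum>j\<in>{1..n}. X j \<omega>"
  let ?D = "{\<omega>\<in>\<Omega>. \<theta> < \<bar>?Y \<omega> / real n\<bar>}"
  have XX: "\<bar>X j \<omega> * X j' \<omega>\<bar> \<le> 1" for j j' \<omega>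
    using bound[of j \<omega>] bound[of j' \<omega>] by (simp add: abs_mult mult_le_one)
  have "(\<Sum>\<omega>\<in>\<Omega>. (?Y \<omega>)\<^sup>2) = (\<Sum>\<omega>\<in>\<Omega>. \<Sum>j\<in>{1..n}. \<Sum>j'\<in>{1..n}. X j \<omega> * X j' \<omega>)"
    by (simp add: power2_eq_square sum_product)
  also have "\<dots> = (\<Sum>j\<in>{1..n}. \<Sum>j'\<in>{1..n}. \<Sum>\<omega>\<in>\<Omega>. X j \<omega> * X j' \<omega>)"
    by (subst sum.swap, intro sum.cong refl, rule sum.swap)
  also have "\<dots> \<le> (\<Sum>j\<in>{1..n}. 2 * real (card \<Omega>))"
  proof (rule sum_mono)
    fix j assume j: "j \<in> {1..n}"
    have "(\<Sum>j'\<in>{1..n}. \<Sum>\<omega>\<in>\<Omega>. X j \<omega> * X j' \<omega>)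
        = (\<Sum>j'\<in>{1..n} \<inter> N j. \<Sum>\<omega>\<in>\<Omega>. X j \<omega> * X j' \<omega>)"
      using orth[OF j] by (intro sum.mono_neutral_right) auto
    also have "\<dots> \<le> (\<Sum>j'\<in>{1..n} \<inter> N j. \<Sum>\<omega>\<in>\<Omega>. 1)"
      using XX by (intro sum_mono) (meson abs_le_D1)
    also have "\<dots> = real (card ({1..n} \<inter> N j)) * real (card \<Omega>)" by simp
    also have "card ({1..n} \<inter> N j) \<le> 2"
      using N[OF j] by (meson card_mono inf.cobounded2 le_trans)
    then have "real (card ({1..n} \<inter> N j)) * real (card \<Omega>) \<le> 2 * real (card \<Omega>)"
      by (intro mult_right_mono) auto
    finally show "(\<Sum>j'\<in>{1..n}. \<Sum>\<omega>\<in>\<Omega>. X j \<omega> * X j' \<omega>) \<le> 2 * real (card \<Omega>)" .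
  qed
  finally have second: "(\<Sum>\<omega>\<in>\<Omega>. (?Y \<omega>)\<^sup>2) \<le> real n * (2 * real (card \<Omega>))" by simp
  have "real (card ?D) * (\<theta> * real n)\<^sup>2 = (\<Sum>\<omega>\<in>?D. (\<theta> * real n)\<^sup>2)" by simp
  also have "\<dots> \<le> (\<Sum>\<omega>\<in>?D. (?Y \<omega>)\<^sup>2)"
  proof (rule sum_mono)
    fix \<omega> assume "\<omega> \<in> ?D"
    then have "\<theta> * real n \<le> \<bar>?Y \<omega>\<bar>" using assms(2) by (simp add: field_simps)
    then have "(\<theta> * real n)\<^sup>2 \<le> \<bar>?Y \<omega>\<bar>\<^sup>2" using assms(2,3) by (intro power_mono) auto
    then show "(\<theta> * real n)\<^sup>2 \<le> (?Y \<omega>)\<^sup>2" by simp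
  qed
  also have "\<dots> \<le> (\<Sum>\<omega>\<in>\<Omega>. (?Y \<omega>)\<^sup>2)"
    using fin by (intro sum_mono2) auto
  finally have "real (card ?D) * (\<theta> * real n)\<^sup>2 \<le> real n * (2 * real (card \<Omega>))"
    using second by linarith
  then have "real n * (real (card ?D) * (real n * \<theta>\<^sup>2)) \<le> real n * (2 * real (card \<Omega>))"
    by (simp add: power2_eq_square algebra_simps)
  then show ?thesis using assms(2,3) by (simp add: le_divide_eq)
qed

text \<open>The deviation of the indicator of \<open>c j = l\<close> from its mean, for \<open>c\<close> uniform in \<open>J \<rightarrow>\<^sub>E B\<close>.\<close>

definition noise :: "'b set \<Rightarrow> 'b \<Rightarrow> 'a set \<Rightarrow> ('a \<Rightarrow> 'b) \<Rightarrow> 'a \<Rightarrow> real" where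
  "noise B l J c j = (if j \<in> J then of_bool (c j = l) - 1 / real (card B) else 0)"

lemma abs_noise_le_1: "\<bar>noise B l J c j\<bar> \<le> 1"
proof -
  have "1 / real (card B) \<le> 1" by (cases "card B = 0") auto
  moreover have "0 \<le> 1 / real (card B)" by simp
  ultimately show ?thesis unfolding noise_def by auto
qed

lemma noise_upd: "j \<noteq> a \<Longrightarrow> noise B l J (c(a := y)) j = noise B l J c j"
  by (simp add: noise_def)

text \<open>Independence of coordinates in elementary form: h ignores the colour at a, so the sum
  factorises, and \<open>of_bool (y = l) - 1 / real (card B)\<close> sums to zero over the colours
  y. Outside J the noise is zero by definition.\<close>

lemma sum_noise_mult_eq_0:
  assumes "finite B" and "l \<in> B" and h: "\<And>c y. h (c(a := y)) = h c"
  shows "(\<Sum>c\<in>J \<rightarrow>\<^sub>E B. noise B l J c a * h c) = 0"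
proof (cases "a \<in> J")
  case True
  define J' where "J' = J - {a}"
  have J: "J = insert a J'" and a: "a \<notin> J'" using True by (auto simp: J'_def)
  have B0: "card B \<noteq> 0" using assms(1,2) by auto
  have "(\<Sum>c\<in>J \<rightarrow>\<^sub>E B. noise B l J c a * h c)
      = (\<Sum>(y, c)\<in>B \<times> (J' \<rightarrow>\<^sub>E B). noise B l J (c(a := y)) a * h (c(a := y)))"
    unfolding J PiE_insert_eq
    by (subst sum.reindex) (use inj_combinator[OF a] in \<open>auto simp: case_prod_beta J[symmetric]\<close>)
  also have "\<dots> = (\<Sum>(y, c)\<in>B \<times> (J' \<rightarrow>\<^sub>E B). (of_bool (y = l) - 1 / real (card B)) * h c)"
    using True by (simp add: noise_def h)
  also have "\<dots> = (\<Sum>y\<in>B. of_bool (y = l) - 1 / real (card B)) * (\<Sum>c\<in>J' \<rightarrow>\<^sub>E B. h c)"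
    by (simp add: sum_product sum.cartesian_product)
  also have "(\<Sum>y\<in>B. of_bool (y = l) - 1 / real (card B)) = 0"
    using assms(1,2) B0 by (simp add: sum_subtractf)
  finally show ?thesis by simp
qed (simp add: noise_def)

text \<open>When a and b invert the permutations of two group elements, this is the inner product of
  the corresponding translates of f and g for the uniform measure.\<close>

definition corr ::
  "nat \<Rightarrow> (nat \<Rightarrow> nat) \<Rightarrow> (nat \<Rightarrow> nat) \<Rightarrow> (nat \<Rightarrow> real) \<Rightarrow> (nat \<Rightarrow> real) \<Rightarrow> real" where
  "corr n a b f g = (\<Sum>j\<in>{1..n}. f (a j) * g (b j)) / real n"

text \<open>Here f is deterministic: later the centred indicator of J or the constant 1. As b is
  injective, distinct indices read the noise at distinct points, so each index correlates only with
  itself.\<close>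

lemma card_linear_deviation_le:
  assumes "finite B" and "l \<in> B" and "finite J" and "0 < n" and "0 < \<theta>"
    and inj: "inj_on b {1..n}" and f: "\<And>j. \<bar>f j\<bar> \<le> 1"
  shows "real (card {c\<in>J \<rightarrow>\<^sub>E B. \<theta> < \<bar>corr n a b f (noise B l J c)\<bar>})
    \<le> 2 * real (card (J \<rightarrow>\<^sub>E B)) / (real n * \<theta>\<^sup>2)"
  unfolding corr_def
proof (rule card_deviation_le[where N = "\<lambda>j. {j}"])
  show "finite (J \<rightarrow>\<^sub>E B)" using assms(1,3) by (simp add: finite_PiE)
  show "\<bar>f (a j) * noise B l J c (b j)\<bar> \<le> 1" for j c
    using f[of "a j"] abs_noise_le_1[of B l J c "b j"] by (simp add: abs_mult mult_le_one)
  fix j j' assume "j \<in> {1..n}" "j' \<in> {1..n}" "j' \<notin> {j}"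
  then have ne: "b j' \<noteq> b j" using inj_onD[OF inj, of j' j] by blast
  have "(\<Sum>c\<in>J \<rightarrow>\<^sub>E B. noise B l J c (b j) * (f (a j) * f (a j') * noise B l J c (b j'))) = 0"
    using ne by (intro sum_noise_mult_eq_0 assms(1,2)) (simp add: noise_upd)
  then show "(\<Sum>c\<in>J \<rightarrow>\<^sub>E B. (f (a j) * noise B l J c (b j)) * (f (a j') * noise B l J c (b j'))) = 0"
    by (simp only: mult_ac)
qed (use assms in auto)

text \<open>Where a j = b j the summand is a square and need not average to zero, but by
  \<open>few\<close> such indices contribute at most one of the two \<theta> in the threshold. The
  other summands are products of the noise at two distinct points, orthogonal unless they use the
  same pair of points. Injectivity of a allows at most two indices per pair.\<close>

lemma card_quadratic_deviation_le:
  assumes "finite B" and "l \<in> B" and "finite J" and "0 < n" and "0 < \<theta>"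
    and a: "inj_on a {1..n}" and b: "inj_on b {1..n}"
    and few: "real (card {j\<in>{1..n}. a j = b j}) \<le> \<theta> * real n"
  shows "real (card {c\<in>J \<rightarrow>\<^sub>E B. 2 * \<theta> < \<bar>corr n a b (noise B l J c) (noise B l J c)\<bar>})
    \<le> 2 * real (card (J \<rightarrow>\<^sub>E B)) / (real n * \<theta>\<^sup>2)"
proof -
  define X where "X j c = (if a j = b j then 0 else noise B l J c (a j) * noise B l J c (b j))" for j c
  define N where "N j = {j' \<in> {1..n}. {a j', b j'} = {a j, b j}}" for j
  have fin: "finite (J \<rightarrow>\<^sub>E B)" using assms(1,3) by (simp add: finite_PiE)
  have ww: "\<bar>noise B l J c i * noise B l J c i'\<bar> \<le> 1" for c i i'
    by (simp add: abs_mult mult_le_one abs_noise_le_1)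
  have dev: "real (card {c\<in>J \<rightarrow>\<^sub>E B. \<theta> < \<bar>(\<Sum>j\<in>{1..n}. X j c) / real n\<bar>})
    \<le> 2 * real (card (J \<rightarrow>\<^sub>E B)) / (real n * \<theta>\<^sup>2)"
  proof (rule card_deviation_le[OF fin assms(4,5), where N = N])
    show "\<bar>X j c\<bar> \<le> 1" for j c using ww by (simp add: X_def)
  next
    fix j assume "j \<in> {1..n}"
    have "N j \<subseteq> ({1..n} \<inter> a -` {a j}) \<union> ({1..n} \<inter> a -` {b j})"
      by (auto simp: N_def doubleton_eq_iff)
    then have "card (N j) \<le> card (({1..n} \<inter> a -` {a j}) \<union> ({1..n} \<inter> a -` {b j}))"
      by (intro card_mono) auto
    also have "\<dots> \<le> card ({1..n} \<inter> a -` {a j}) + card ({1..n} \<inter> a -` {b j})"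
      by (rule card_Un_le)
    also have "\<dots> \<le> 1 + 1"
    proof -
      have "card ({1..n} \<inter> a -` {x}) \<le> 1" for x
      proof -
        have "card ({1..n} \<inter> a -` {x}) = card (a ` ({1..n} \<inter> a -` {x}))"
          using a by (intro card_image[symmetric]) (blast intro: inj_on_subset)
        also have "\<dots> \<le> card {x}" by (intro card_mono) auto
        finally show ?thesis by simp
      qed
      then show ?thesis by (intro add_mono)
    qed
    finally have "card (N j) \<le> 2" by simp
    then show "finite (N j) \<and> card (N j) \<le> 2" by (simp add: N_def)
  next
    fix j j' assume j: "j \<in> {1..n}" "j' \<in> {1..n}" "j' \<notin> N j"
    show "(\<Sum>c\<in>J \<rightarrow>\<^sub>E B. X j c * X j' c) = 0"
    proof (cases "a j = b j \<or> a j' = b j'")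
      case False
      have ne: "a j \<noteq> b j" "a j' \<noteq> b j'" using False by auto
      have eq: "X j c * X j' c = noise B l J c (a j) * noise B l J c (b j)
          * (noise B l J c (a j') * noise B l J c (b j'))" for c
        using ne by (simp add: X_def)
      have *: "(\<Sum>c\<in>J \<rightarrow>\<^sub>E B. noise B l J c p * (noise B l J c q * noise B l J c r * noise B l J c s)) = 0"
        if "p \<noteq> q" "p \<noteq> r" "p \<noteq> s" for p q r s
        using that by (intro sum_noise_mult_eq_0 assms(1,2)) (simp add: noise_upd)
      from j have "{a j', b j'} \<noteq> {a j, b j}" by (auto simp: N_def)
      \<comment> \<open>Neither of two distinct two-element sets contains the other, so one point of
        index j occurs in none of the other three factors and can be averaged out.\<close>
      then have "a j \<notin> {a j', b j'} \<or> b j \<notin> {a j', b j'}"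
        using ne by (metis doubleton_eq_iff insertE singletonD)
      then consider "a j \<noteq> a j'" "a j \<noteq> b j'" | "b j \<noteq> a j'" "b j \<noteq> b j'"
        by blast
      then show ?thesis
      proof cases
        case 1
        then show ?thesis using *[of "a j" "b j" "a j'" "b j'"] ne(1) unfolding eq
          by (simp only: mult.assoc simp_thms)
      next
        case 2
        then have "(\<Sum>c\<in>J \<rightarrow>\<^sub>E B. noise B l J c (b j)
            * (noise B l J c (a j) * noise B l J c (a j') * noise B l J c (b j'))) = 0"
          using ne(1) by (intro *) auto
        then show ?thesis unfolding eq by (simp only: mult_ac)
      qed
    qed (auto simp: X_def)
  qed
  have sub: "\<bar>corr n a b (noise B l J c) (noise B l J c)\<bar> \<le> \<bar>(\<Sum>j\<in>{1..n}. X j c) / real n\<bar> + \<theta>" for c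
  proof -
    let ?w = "noise B l J c"
    have "(\<Sum>j\<in>{1..n}. ?w (a j) * ?w (b j))
        = (\<Sum>j\<in>{1..n}. X j c + (if a j = b j then ?w (a j) * ?w (b j) else 0))"
      by (intro sum.cong) (auto simp: X_def)
    also have "\<dots> = (\<Sum>j\<in>{1..n}. X j c) + (\<Sum>j\<in>{j\<in>{1..n}. a j = b j}. ?w (a j) * ?w (b j))"
      by (subst sum.inter_filter) (simp_all add: sum.distrib)
    finally have eq: "(\<Sum>j\<in>{1..n}. ?w (a j) * ?w (b j))
      = (\<Sum>j\<in>{1..n}. X j c) + (\<Sum>j\<in>{j\<in>{1..n}. a j = b j}. ?w (a j) * ?w (b j))" .
    have "\<bar>\<Sum>j\<in>{j\<in>{1..n}. a j = b j}. ?w (a j) * ?w (b j)\<bar>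
        \<le> (\<Sum>j\<in>{j\<in>{1..n}. a j = b j}. \<bar>?w (a j) * ?w (b j)\<bar>)"
      by (rule sum_abs)
    also have "\<dots> \<le> (\<Sum>j\<in>{j\<in>{1..n}. a j = b j}. 1)"
      using ww by (intro sum_mono)
    also have "\<dots> \<le> \<theta> * real n" using few by simp
    finally have "\<bar>\<Sum>j\<in>{1..n}. ?w (a j) * ?w (b j)\<bar> \<le> \<bar>\<Sum>j\<in>{1..n}. X j c\<bar> + \<theta> * real n"
      unfolding eq by linarith
    then have "\<bar>\<Sum>j\<in>{1..n}. ?w (a j) * ?w (b j)\<bar> / real n
        \<le> (\<bar>\<Sum>j\<in>{1..n}. X j c\<bar> + \<theta> * real n) / real n"
      by (rule divide_right_mono) simp
    then show ?thesis using assms(4) by (simp add: corr_def add_divide_distrib)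
  qed
  have "{c\<in>J \<rightarrow>\<^sub>E B. 2 * \<theta> < \<bar>corr n a b (noise B l J c) (noise B l J c)\<bar>}
      \<subseteq> {c\<in>J \<rightarrow>\<^sub>E B. \<theta> < \<bar>(\<Sum>j\<in>{1..n}. X j c) / real n\<bar>}"
  proof safe
    fix c assume "2 * \<theta> < \<bar>corr n a b (noise B l J c) (noise B l J c)\<bar>"
    then show "\<theta> < \<bar>(\<Sum>j\<in>{1..n}. X j c) / real n\<bar>" using sub[of c] by linarith
  qed
  then have "card {c\<in>J \<rightarrow>\<^sub>E B. 2 * \<theta> < \<bar>corr n a b (noise B l J c) (noise B l J c)\<bar>}
      \<le> card {c\<in>J \<rightarrow>\<^sub>E B. \<theta> < \<bar>(\<Sum>j\<in>{1..n}. X j c) / real n\<bar>}"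
    using fin by (intro card_mono) auto
  then show ?thesis using dev by linarith
qed

section \<open>Displaced correlations and the norm of \<sigma>(\<alpha>)\<close>

lemma corr_commute: "corr n a b f g = corr n b a g f"
  by (simp add: corr_def mult.commute)

lemma corr_add_left: "corr n a b (\<lambda>j. f j + f' j) g = corr n a b f g + corr n a b f' g"
  by (simp add: corr_def distrib_right sum.distrib add_divide_distrib)

lemma corr_add_right: "corr n a b f (\<lambda>j. g j + g' j) = corr n a b f g + corr n a b f g'"
  by (simp add: corr_def distrib_left sum.distrib add_divide_distrib)

lemma corr_scale_left: "corr n a b (\<lambda>j. t * f j) g = t * corr n a b f g"
  by (simp add: corr_def sum_distrib_left mult.assoc)

lemma corr_scale_right: "corr n a b f (\<lambda>j. t * g j) = t * corr n a b f g"
  by (simp add: corr_def sum_distrib_left mult.left_commute)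

lemma corr_permutes_same:
  assumes "a permutes {1..n}"
  shows "corr n a a f g = corr n id id f g"
  unfolding corr_def using sum.permute[OF assms, of "\<lambda>j. f j * g j"] by (simp add: o_def)

lemma corr_const_left:
  assumes "b permutes {1..n}"
  shows "corr n a b (\<lambda>j. t) g = t * ((\<Sum>j\<in>{1..n}. g j) / real n)"
  unfolding corr_def using sum.permute[OF assms, of g]
  by (simp add: o_def sum_distrib_left)

lemma unif_norm2_of_real: "(unif_norm2 n (\<lambda>j. of_real (f j)))\<^sup>2 = corr n id id f f"
  unfolding unif_norm2_def corr_def
  by (subst real_sqrt_pow2) (simp_all add: sum_nonneg power2_eq_square[symmetric])

lemma unif_norm2_nonneg: "0 \<le> unif_norm2 n \<xi>"
  by (simp add: unif_norm2_def sum_nonneg)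

lemma Re_mult_cnj: "(cmod z)\<^sup>2 = Re (z * cnj z)"
  unfolding cmod_power2 by (simp add: power2_eq_square)

text \<open>Expanding the square leaves a Gram sum over pairs of group elements, whose entries are
  what the moment bounds control.\<close>

lemma unif_norm2_sofic_op_of_real:
  fixes s :: "'g \<Rightarrow> nat \<Rightarrow> nat"
  shows "(unif_norm2 n (sofic_op s \<alpha> (\<lambda>j. of_real (f j))))\<^sup>2
    = (\<Sum>g\<in>Poly_Mapping.keys \<alpha>. \<Sum>h\<in>Poly_Mapping.keys \<alpha>.
        Re (Poly_Mapping.lookup \<alpha> g * cnj (Poly_Mapping.lookup \<alpha> h))
        * corr n (inv_into UNIV (s g)) (inv_into UNIV (s h)) f f)"
proof -
  let ?K = "Poly_Mapping.keys \<alpha>" and ?a = "Poly_Mapping.lookup \<alpha>"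
  have sq: "(cmod (\<Sum>g\<in>?K. ?a g * of_real (x g)))\<^sup>2
      = (\<Sum>g\<in>?K. \<Sum>h\<in>?K. Re (?a g * cnj (?a h)) * (x g * x h))" for x :: "'g \<Rightarrow> real"
  proof -
    let ?z = "\<Sum>g\<in>?K. ?a g * of_real (x g)"
    have "(cmod ?z)\<^sup>2 = Re (?z * cnj ?z)"
      by (rule Re_mult_cnj)
    also have "\<dots> = (\<Sum>g\<in>?K. \<Sum>h\<in>?K. Re (?a g * of_real (x g) * cnj (?a h * of_real (x h))))"
      by (simp only: cnj_sum sum_product Re_sum)
    also have "\<dots> = (\<Sum>g\<in>?K. \<Sum>h\<in>?K. Re (?a g * cnj (?a h)) * (x g * x h))"
      by (intro sum.cong refl) (simp add: algebra_simps)
    finally show ?thesis .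
  qed
  have "(unif_norm2 n (sofic_op s \<alpha> (\<lambda>j. of_real (f j))))\<^sup>2
      = (\<Sum>j\<in>{1..n}. (cmod (sofic_op s \<alpha> (\<lambda>j. of_real (f j)) j))\<^sup>2) / real n"
    unfolding unif_norm2_def by (subst real_sqrt_pow2) (simp_all add: sum_nonneg)
  also have "\<dots> = (\<Sum>j\<in>{1..n}. \<Sum>g\<in>?K. \<Sum>h\<in>?K. Re (?a g * cnj (?a h))
      * (f (inv_into UNIV (s g) j) * f (inv_into UNIV (s h) j))) / real n"
    unfolding sofic_op_def by (simp only: sq)
  also have "(\<Sum>j\<in>{1..n}. \<Sum>g\<in>?K. \<Sum>h\<in>?K. Re (?a g * cnj (?a h))
        * (f (inv_into UNIV (s g) j) * f (inv_into UNIV (s h) j)))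
      = (\<Sum>g\<in>?K. \<Sum>h\<in>?K. Re (?a g * cnj (?a h))
        * (\<Sum>j\<in>{1..n}. f (inv_into UNIV (s g) j) * f (inv_into UNIV (s h) j)))"
    by (subst sum.swap, intro sum.cong refl, subst sum.swap) (simp only: sum_distrib_left)
  also have "\<dots> / real n = (\<Sum>g\<in>?K. \<Sum>h\<in>?K. Re (?a g * cnj (?a h)) * corr n (inv_into UNIV (s g)) (inv_into UNIV (s h)) f f)"
    by (simp add: corr_def flip: sum_divide_distrib)
  finally show ?thesis .
qed

text \<open>After expansion of the square, the v-part is bounded by \<open>op_v\<close>, and the
  diagonal of the z-part is |\<alpha>|_2^2 |z|^2 because permutations preserve the norm. The two
  parts then recombine to L^2 |p v + z|^2. In 5 M^2 \<theta>, three units come from two cross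
  correlations and one off-diagonal noise correlation, two from the recombination; 3 M \<eta>' comes
  from squaring \<open>op_v\<close>.\<close>

lemma sofic_op_norm_le:
  fixes s :: "'g \<Rightarrow> nat \<Rightarrow> nat" and \<alpha> :: "'g \<Rightarrow>\<^sub>0 complex" and v z :: "nat \<Rightarrow> real"
  defines "A \<equiv> \<Sum>g\<in>Poly_Mapping.keys \<alpha>. cmod (Poly_Mapping.lookup \<alpha> g)"
  assumes "0 < n"
    and perm: "\<And>g. g \<in> Poly_Mapping.keys \<alpha> \<Longrightarrow> inv_into UNIV (s g) permutes {1..n}"
    and L: "0 \<le> L" "(\<Sum>g\<in>Poly_Mapping.keys \<alpha>. (cmod (Poly_Mapping.lookup \<alpha> g))\<^sup>2) \<le> L\<^sup>2"
    and p: "0 \<le> p" "p \<le> 1"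
    and v: "\<And>j. \<bar>v j\<bar> \<le> 1"
    and op_v: "unif_norm2 n (sofic_op s \<alpha> (\<lambda>j. of_real (v j))) \<le> L * unif_norm2 n (\<lambda>j. of_real (v j)) + \<eta>'"
    and vz: "\<And>g h. g \<in> Poly_Mapping.keys \<alpha> \<Longrightarrow> h \<in> Poly_Mapping.keys \<alpha> \<Longrightarrow>
      \<bar>corr n (inv_into UNIV (s g)) (inv_into UNIV (s h)) v z\<bar> \<le> \<theta>"
    and vz1: "\<bar>corr n id id v z\<bar> \<le> \<theta>"
    and zz: "\<And>g h. g \<in> Poly_Mapping.keys \<alpha> \<Longrightarrow> h \<in> Poly_Mapping.keys \<alpha> \<Longrightarrow> g \<noteq> h \<Longrightarrow>
      \<bar>corr n (inv_into UNIV (s g)) (inv_into UNIV (s h)) z z\<bar> \<le> \<theta>"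
    and M: "A \<le> M" "L \<le> M" "1 \<le> M"
    and "0 < \<eta>" and \<eta>': "0 \<le> \<eta>'" "\<eta>' \<le> 1" "3 * M * \<eta>' \<le> \<eta>\<^sup>2 / 2" and \<theta>: "0 \<le> \<theta>" "5 * M\<^sup>2 * \<theta> \<le> \<eta>\<^sup>2 / 2"
  shows "unif_norm2 n (sofic_op s \<alpha> (\<lambda>j. of_real (p * v j + z j)))
    \<le> L * unif_norm2 n (\<lambda>j. of_real (p * v j + z j)) + \<eta>"
proof -
  let ?K = "Poly_Mapping.keys \<alpha>" and ?a = "Poly_Mapping.lookup \<alpha>"
  let ?f = "\<lambda>j. p * v j + z j"
  let ?C = "\<lambda>g h. corr n (inv_into UNIV (s g)) (inv_into UNIV (s h))"
  let ?R = "\<lambda>g h. Re (?a g * cnj (?a h))"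
  define Nv where "Nv = corr n id id v v"
  define Nz where "Nz = corr n id id z z"
  define Nf where "Nf = corr n id id ?f ?f"
  have N0: "0 \<le> Nv" "0 \<le> Nz" "0 \<le> Nf"
    by (simp_all add: Nv_def Nz_def Nf_def corr_def sum_nonneg)
  have "(\<Sum>j\<in>{1..n}. v j * v j) \<le> (\<Sum>j\<in>{1..n}. 1)"
  proof (rule sum_mono)
    fix j show "v j * v j \<le> 1"
      using v[of j] abs_square_le_1[of "v j"] by (simp add: power2_eq_square)
  qed
  then have Nv1: "Nv \<le> 1" using assms(2) by (simp add: Nv_def corr_def)
  have expand: "corr n a b ?f ?f = p\<^sup>2 * corr n a b v v
      + (p * corr n a b v z + p * corr n b a v z + corr n a b z z)" for a b
    by (simp add: corr_add_left corr_add_right corr_scale_left corr_scale_right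
        corr_commute[of n a b z v] power2_eq_square algebra_simps)
  \<comment> \<open>The diagonal noise term is kept exactly, as it is not small; all other terms
    share the bound 3 \<theta>, which is generous on the diagonal.\<close>
  have summand: "?R g h * (p * ?C g h v z + p * ?C h g v z + ?C g h z z)
      \<le> cmod (?a g) * cmod (?a h) * (3 * \<theta>) + (if g = h then (cmod (?a g))\<^sup>2 * Nz else 0)"
    if g: "g \<in> ?K" and h: "h \<in> ?K" for g h
  proof -
    have R: "\<bar>?R g h\<bar> \<le> cmod (?a g) * cmod (?a h)"
      using abs_Re_le_cmod[of "?a g * cnj (?a h)"] by (simp add: norm_mult)
    have pb: "\<bar>p * x\<bar> \<le> \<theta>" if "\<bar>x\<bar> \<le> \<theta>" for x
      using p that mult_mono[of p 1 "\<bar>x\<bar>" \<theta>] by (simp add: abs_mult)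
    have two: "\<bar>p * ?C g h v z + p * ?C h g v z\<bar> \<le> 2 * \<theta>"
      using pb[OF vz[OF g h]] pb[OF vz[OF h g]] by linarith
    show ?thesis
    proof (cases "g = h")
      case True
      have Rg: "?R g g = (cmod (?a g))\<^sup>2"
        by (rule Re_mult_cnj[symmetric])
      have "?R g g * (p * ?C g g v z + p * ?C g g v z) \<le> (cmod (?a g))\<^sup>2 * (3 * \<theta>)"
        unfolding Rg using two True \<theta> by (intro mult_left_mono) auto
      moreover have "?C g g z z = Nz" unfolding Nz_def by (rule corr_permutes_same[OF perm[OF g]])
      ultimately have "?R g g * (p * ?C g g v z + p * ?C g g v z + ?C g g z z)
          \<le> (cmod (?a g))\<^sup>2 * (3 * \<theta>) + (cmod (?a g))\<^sup>2 * Nz"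
        unfolding Rg distrib_left[of _ _ "?C g g z z"] by (simp only: add_mono order_refl)
      then show ?thesis unfolding True[symmetric] by (simp only: power2_eq_square simp_thms if_True)
    next
      case False
      have "\<bar>p * ?C g h v z + p * ?C h g v z + ?C g h z z\<bar> \<le> 3 * \<theta>"
        using two zz[OF g h False] by linarith
      then have "\<bar>?R g h\<bar> * \<bar>p * ?C g h v z + p * ?C h g v z + ?C g h z z\<bar>
          \<le> cmod (?a g) * cmod (?a h) * (3 * \<theta>)"
        using R by (intro mult_mono) auto
      then show ?thesis using False by (simp flip: abs_mult)
    qed
  qed
  have "(unif_norm2 n (sofic_op s \<alpha> (\<lambda>j. of_real (?f j))))\<^sup>2
      = (\<Sum>g\<in>?K. \<Sum>h\<in>?K. p\<^sup>2 * (?R g h * ?C g h v v)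
          + ?R g h * (p * ?C g h v z + p * ?C h g v z + ?C g h z z))"
    unfolding unif_norm2_sofic_op_of_real expand by (simp only: distrib_left mult.left_commute)
  also have "\<dots> = p\<^sup>2 * (unif_norm2 n (sofic_op s \<alpha> (\<lambda>j. of_real (v j))))\<^sup>2
      + (\<Sum>g\<in>?K. \<Sum>h\<in>?K. ?R g h * (p * ?C g h v z + p * ?C h g v z + ?C g h z z))"
    unfolding unif_norm2_sofic_op_of_real by (simp only: sum.distrib sum_distrib_left)
  also have "\<dots> \<le> p\<^sup>2 * (L * unif_norm2 n (\<lambda>j. of_real (v j)) + \<eta>')\<^sup>2
      + (\<Sum>g\<in>?K. \<Sum>h\<in>?K. cmod (?a g) * cmod (?a h) * (3 * \<theta>)
          + (if g = h then (cmod (?a g))\<^sup>2 * Nz else 0))"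
    by (intro add_mono mult_left_mono power_mono sum_mono summand op_v unif_norm2_nonneg) auto
  also have "(\<Sum>g\<in>?K. \<Sum>h\<in>?K. cmod (?a g) * cmod (?a h) * (3 * \<theta>)
          + (if g = h then (cmod (?a g))\<^sup>2 * Nz else 0))
      = A * A * (3 * \<theta>) + (\<Sum>g\<in>?K. (cmod (?a g))\<^sup>2) * Nz"
  proof -
    have "A * A * (3 * \<theta>) = (\<Sum>g\<in>?K. \<Sum>h\<in>?K. cmod (?a g) * cmod (?a h) * (3 * \<theta>))"
    proof -
      have "A * A = (\<Sum>g\<in>?K. \<Sum>h\<in>?K. cmod (?a g) * cmod (?a h))"
        by (simp only: A_def sum_product)
      then show ?thesis by (simp only: sum_distrib_right)
    qed
    moreover have "(\<Sum>g\<in>?K. (cmod (?a g))\<^sup>2) * Nz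
        = (\<Sum>g\<in>?K. \<Sum>h\<in>?K. if g = h then (cmod (?a g))\<^sup>2 * Nz else 0)"
      by (simp add: sum_distrib_right)
    ultimately show ?thesis by (simp only: sum.distrib)
  qed
  also have "(L * unif_norm2 n (\<lambda>j. of_real (v j)) + \<eta>')\<^sup>2 \<le> L\<^sup>2 * Nv + 3 * M * \<eta>'"
  proof -
    let ?u = "unif_norm2 n (\<lambda>j. of_real (v j))"
    have u: "?u\<^sup>2 = Nv" by (simp add: Nv_def unif_norm2_of_real)
    then have "?u\<^sup>2 \<le> 1\<^sup>2" using Nv1 by simp
    then have u1: "?u \<le> 1" by (rule power2_le_imp_le) simp
    have "(L * ?u + \<eta>')\<^sup>2 = L\<^sup>2 * Nv + (2 * (L * ?u) + \<eta>') * \<eta>'"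
      by (simp add: u[symmetric] power2_eq_square algebra_simps)
    \<comment> \<open>With \<eta>' \<le> 1 \<le> M this gives 2 L u + \<eta>' \<le> 3 M.\<close>
    also have "L * ?u \<le> M * 1"
      using L M u1 unif_norm2_nonneg by (intro mult_mono) auto
    then have "(2 * (L * ?u) + \<eta>') * \<eta>' \<le> (3 * M) * \<eta>'"
      using \<eta>' M by (intro mult_right_mono) auto
    finally show ?thesis by simp
  qed
  finally have "(unif_norm2 n (sofic_op s \<alpha> (\<lambda>j. of_real (?f j))))\<^sup>2
      \<le> p\<^sup>2 * (L\<^sup>2 * Nv + 3 * M * \<eta>') + (A * A * (3 * \<theta>) + (\<Sum>g\<in>?K. (cmod (?a g))\<^sup>2) * Nz)"
    by (simp add: mult_left_mono)
  also have "\<dots> \<le> p\<^sup>2 * (L\<^sup>2 * Nv) + \<eta>\<^sup>2 / 2 + (3 * M\<^sup>2 * \<theta> + L\<^sup>2 * Nz)"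
  proof -
    have "p\<^sup>2 * (3 * M * \<eta>') \<le> 1 * (3 * M * \<eta>')"
      using p M \<eta>' by (intro mult_right_mono) (auto simp: power_le_one)
    moreover have "A * A * (3 * \<theta>) \<le> M * M * (3 * \<theta>)"
      using M \<theta> by (intro mult_right_mono mult_mono) (auto simp: A_def sum_nonneg)
    moreover have "(\<Sum>g\<in>?K. (cmod (?a g))\<^sup>2) * Nz \<le> L\<^sup>2 * Nz"
      using L N0 by (intro mult_right_mono) auto
    ultimately show ?thesis using \<eta>' by (simp add: power2_eq_square distrib_left algebra_simps)
  qed
  \<comment> \<open>Orthogonality without displacement, \<open>vz1\<close>, replaces the sum of the
    two squared norms by the squared norm of the sum.\<close>
  also have "\<dots> \<le> L\<^sup>2 * Nf + \<eta>\<^sup>2"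
  proof -
    have "Nf = p\<^sup>2 * Nv + 2 * p * corr n id id v z + Nz"
      unfolding Nf_def expand by (simp add: Nv_def Nz_def)
    moreover have "\<bar>2 * p * corr n id id v z\<bar> \<le> 2 * \<theta>"
      using p vz1 mult_mono[of p 1 "\<bar>corr n id id v z\<bar>" \<theta>] by (simp add: abs_mult)
    ultimately have "p\<^sup>2 * Nv + Nz \<le> Nf + 2 * \<theta>" by linarith
    then have "L\<^sup>2 * (p\<^sup>2 * Nv + Nz) \<le> L\<^sup>2 * (Nf + 2 * \<theta>)"
      by (intro mult_left_mono) auto
    moreover have "L\<^sup>2 * (2 * \<theta>) \<le> M\<^sup>2 * (2 * \<theta>)"
      using L M \<theta> by (intro mult_right_mono power_mono) auto
    ultimately show ?thesis using \<theta> by (simp add: algebra_simps)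
  qed
  \<comment> \<open>The two errors, each at most \<eta>^2 / 2, fit into the \<eta>^2 of the expanded
    square; its mixed term is nonnegative.\<close>
  also have "\<dots> \<le> (L * unif_norm2 n (\<lambda>j. of_real (?f j)) + \<eta>)\<^sup>2"
  proof -
    have "Nf = (unif_norm2 n (\<lambda>j. of_real (?f j)))\<^sup>2" by (simp only: Nf_def unif_norm2_of_real)
    moreover have "0 \<le> L * unif_norm2 n (\<lambda>j. of_real (?f j)) * \<eta>"
      using L(1) \<open>0 < \<eta>\<close> unif_norm2_nonneg by (intro mult_nonneg_nonneg) auto
    ultimately show ?thesis by (simp add: power2_sum power_mult_distrib mult_ac)
  qed
  finally show ?thesis
    by (rule power2_le_imp_le) (use L \<open>0 < \<eta>\<close> unif_norm2_nonneg in \<open>simp add: add_nonneg_nonneg\<close>)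
qed

section \<open>The left regular representation\<close>

lemma has_sum_sum:
  fixes f :: "'i \<Rightarrow> 'x \<Rightarrow> real"
  assumes "finite A" and "\<And>a. a \<in> A \<Longrightarrow> (f a has_sum s a) B"
  shows "((\<lambda>x. \<Sum>a\<in>A. f a x) has_sum (\<Sum>a\<in>A. s a)) B"
  using assms by (induction A rule: finite_induct) (auto intro: has_sum_add)

context group
begin

lemma bij_betw_inv_mult_left:
  assumes "g \<in> carrier G"
  shows "bij_betw (\<lambda>h. inv g \<otimes> h) (carrier G) (carrier G)"
proof (rule bij_betwI[where g = "\<lambda>h. g \<otimes> h"])
  fix h assume h: "h \<in> carrier G"
  show "g \<otimes> (inv g \<otimes> h) = h" "inv g \<otimes> (g \<otimes> h) = h"
    using assms h m_assoc[of g "inv g" h] m_assoc[of "inv g" g h] by simp_all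
qed (use assms in auto)

text \<open>Triangle inequality and Cauchy-Schwarz over the support, then translation invariance of
  the sum. The crude constant serves to show that the supremum in \<open>left_reg_norm\<close>,
  taken in the reals, is over a bounded set.\<close>

lemma left_reg_bounded:
  assumes \<alpha>: "\<alpha> \<in> group_ring G" and \<xi>: "\<xi> \<in> ell2 G"
  shows "left_reg G \<alpha> \<xi> \<in> ell2 G"
    and "ell2_norm G (left_reg G \<alpha> \<xi>)
      \<le> sqrt ((\<Sum>g\<in>Poly_Mapping.keys \<alpha>. (cmod (Poly_Mapping.lookup \<alpha> g))\<^sup>2)
          * real (card (Poly_Mapping.keys \<alpha>))) * ell2_norm G \<xi>"
proof -
  let ?K = "Poly_Mapping.keys \<alpha>" and ?a = "Poly_Mapping.lookup \<alpha>"
  define S where "S = (\<Sum>\<^sub>\<infinity>h\<in>carrier G. (cmod (\<xi> h))\<^sup>2)"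
  define A where "A = (\<Sum>g\<in>?K. (cmod (?a g))\<^sup>2)"
  have K: "g \<in> carrier G" if "g \<in> ?K" for g using \<alpha> that by (auto simp: group_ring_def)
  have S0: "0 \<le> S" by (simp add: S_def infsum_nonneg)
  have A0: "0 \<le> A" by (simp add: A_def sum_nonneg)
  have hs: "((\<lambda>h. (cmod (\<xi> h))\<^sup>2) has_sum S) (carrier G)"
    using \<xi> unfolding ell2_def S_def by simp
  have "((\<lambda>h. (cmod (\<xi> (inv g \<otimes> h)))\<^sup>2) has_sum S) (carrier G)" if "g \<in> ?K" for g
    using has_sum_reindex_bij_betw[OF bij_betw_inv_mult_left[OF K[OF that]],
        of "\<lambda>h. (cmod (\<xi> h))\<^sup>2" S] hs by simp
  then have "((\<lambda>h. \<Sum>g\<in>?K. (cmod (\<xi> (inv g \<otimes> h)))\<^sup>2) has_sum (\<Sum>g\<in>?K. S)) (carrier G)"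
    by (intro has_sum_sum) auto
  then have dom: "((\<lambda>h. A * (\<Sum>g\<in>?K. (cmod (\<xi> (inv g \<otimes> h)))\<^sup>2)) has_sum (A * (real (card ?K) * S)))
      (carrier G)"
    by (intro has_sum_cmult_right) simp
  have le: "(cmod (left_reg G \<alpha> \<xi> h))\<^sup>2 \<le> A * (\<Sum>g\<in>?K. (cmod (\<xi> (inv g \<otimes> h)))\<^sup>2)" for h
  proof -
    have "cmod (left_reg G \<alpha> \<xi> h) \<le> (\<Sum>g\<in>?K. cmod (?a g) * cmod (\<xi> (inv g \<otimes> h)))"
      unfolding left_reg_def by (rule order_trans[OF norm_sum]) (simp add: norm_mult)
    then have "(cmod (left_reg G \<alpha> \<xi> h))\<^sup>2 \<le> (\<Sum>g\<in>?K. cmod (?a g) * cmod (\<xi> (inv g \<otimes> h)))\<^sup>2"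
      by (intro power_mono) auto
    also have "\<dots> \<le> A * (\<Sum>g\<in>?K. (cmod (\<xi> (inv g \<otimes> h)))\<^sup>2)"
      unfolding A_def by (rule Cauchy_Schwarz_ineq_sum)
    finally show ?thesis .
  qed
  have summ: "(\<lambda>h. (cmod (left_reg G \<alpha> \<xi> h))\<^sup>2) summable_on carrier G"
    by (rule summable_on_comparison_test[OF has_sum_imp_summable[OF dom]]) (use le in auto)
  then show "left_reg G \<alpha> \<xi> \<in> ell2 G" by (simp add: ell2_def)
  have "(\<Sum>\<^sub>\<infinity>h\<in>carrier G. (cmod (left_reg G \<alpha> \<xi> h))\<^sup>2) \<le> A * (real (card ?K) * S)"
    using has_sum_mono[OF has_sum_infsum[OF summ] dom] le by blast
  then have "ell2_norm G (left_reg G \<alpha> \<xi>) \<le> sqrt (A * real (card ?K) * S)"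
    unfolding ell2_norm_def by (simp add: mult.assoc)
  then show "ell2_norm G (left_reg G \<alpha> \<xi>) \<le> sqrt (A * real (card ?K)) * ell2_norm G \<xi>"
    by (simp add: ell2_norm_def S_def real_sqrt_mult)
qed

lemma ell2_norm_nonneg: "0 \<le> ell2_norm G \<xi>"
  by (simp add: ell2_norm_def infsum_nonneg)

lemma ell2_norm_scale: "ell2_norm G (\<lambda>h. c * \<xi> h) = cmod c * ell2_norm G \<xi>"
  by (simp add: ell2_norm_def norm_mult power_mult_distrib infsum_cmult_right' real_sqrt_mult)

lemma left_reg_le_norm_unit:
  assumes \<alpha>: "\<alpha> \<in> group_ring G" and \<xi>: "\<xi> \<in> ell2 G" "ell2_norm G \<xi> \<le> 1"
  shows "ell2_norm G (left_reg G \<alpha> \<xi>) \<le> left_reg_norm G \<alpha>"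
  unfolding left_reg_norm_def
proof (rule cSUP_upper)
  let ?B = "sqrt ((\<Sum>g\<in>Poly_Mapping.keys \<alpha>. (cmod (Poly_Mapping.lookup \<alpha> g))\<^sup>2)
    * real (card (Poly_Mapping.keys \<alpha>)))"
  have B0: "0 \<le> ?B" by (intro real_sqrt_ge_zero mult_nonneg_nonneg sum_nonneg) auto
  show "bdd_above ((\<lambda>\<xi>. ell2_norm G (left_reg G \<alpha> \<xi>)) ` {\<xi> \<in> ell2 G. ell2_norm G \<xi> \<le> 1})"
  proof (rule bdd_aboveI2)
    fix \<zeta> assume "\<zeta> \<in> {\<xi> \<in> ell2 G. ell2_norm G \<xi> \<le> 1}"
    then have "\<zeta> \<in> ell2 G" "ell2_norm G \<zeta> \<le> 1" by auto
    then show "ell2_norm G (left_reg G \<alpha> \<zeta>) \<le> ?B * 1"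
      using left_reg_bounded(2)[OF \<alpha>] mult_left_mono[OF _ B0] order_trans by blast
  qed
qed (use \<xi> in simp)

lemma left_reg_le_norm:
  assumes \<alpha>: "\<alpha> \<in> group_ring G" and \<xi>: "\<xi> \<in> ell2 G"
  shows "ell2_norm G (left_reg G \<alpha> \<xi>) \<le> left_reg_norm G \<alpha> * ell2_norm G \<xi>"
proof (cases "ell2_norm G \<xi> = 0")
  case True
  \<comment> \<open>A vector of norm zero cannot be normalised; by the crude bound its image has
    norm zero too.\<close>
  then show ?thesis using left_reg_bounded(2)[OF \<alpha> \<xi>] by simp
next
  case False
  then have pos: "0 < ell2_norm G \<xi>" using ell2_norm_nonneg[of \<xi>] by linarith
  define c where "c = complex_of_real (1 / ell2_norm G \<xi>)"
  have c: "cmod c = 1 / ell2_norm G \<xi>" using pos by (simp add: c_def norm_divide)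
  have "(\<lambda>h. c * \<xi> h) \<in> ell2 G"
    using \<xi> by (simp add: ell2_def norm_mult power_mult_distrib summable_on_cmult_right)
  moreover have "ell2_norm G (\<lambda>h. c * \<xi> h) \<le> 1"
    using pos by (simp add: ell2_norm_scale c)
  moreover have "left_reg G \<alpha> (\<lambda>h. c * \<xi> h) = (\<lambda>h. c * left_reg G \<alpha> \<xi> h)"
    by (simp add: left_reg_def sum_distrib_left mult.left_commute)
  ultimately have "cmod c * ell2_norm G (left_reg G \<alpha> \<xi>) \<le> left_reg_norm G \<alpha>"
    using left_reg_le_norm_unit[OF \<alpha>, of "\<lambda>h. c * \<xi> h"] by (simp add: ell2_norm_scale)
  then show ?thesis using pos by (simp add: c field_simps)
qed

text \<open>Applied to the unit vector at the identity, \<lambda>(\<alpha>) returns the coefficients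
  of \<alpha>. This is why noise, stretched by about |\<alpha>|_2, does not spoil weak
  containment.\<close>

lemma l2_coeffs_le_left_reg_norm:
  assumes \<alpha>: "\<alpha> \<in> group_ring G"
  shows "0 \<le> left_reg_norm G \<alpha>"
    and "(\<Sum>g\<in>Poly_Mapping.keys \<alpha>. (cmod (Poly_Mapping.lookup \<alpha> g))\<^sup>2) \<le> (left_reg_norm G \<alpha>)\<^sup>2"
proof -
  let ?K = "Poly_Mapping.keys \<alpha>" and ?a = "Poly_Mapping.lookup \<alpha>"
  define \<delta> where "\<delta> h = (if h = \<one> then 1 else 0 :: complex)" for h
  have K: "?K \<subseteq> carrier G" using \<alpha> unfolding group_ring_def by blast
  have hs: "((\<lambda>h. (cmod (\<delta> h))\<^sup>2) has_sum 1) (carrier G)"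
  proof -
    have "((\<lambda>h. (cmod (\<delta> h))\<^sup>2) has_sum (\<Sum>h\<in>{\<one>}. (cmod (\<delta> h))\<^sup>2)) {\<one>}"
      by (rule has_sum_finite) simp
    also have "?this \<longleftrightarrow> ((\<lambda>h. (cmod (\<delta> h))\<^sup>2) has_sum (\<Sum>h\<in>{\<one>}. (cmod (\<delta> h))\<^sup>2)) (carrier G)"
      by (rule has_sum_cong_neutral) (auto simp: \<delta>_def)
    finally show ?thesis by (simp add: \<delta>_def)
  qed
  have \<delta>: "\<delta> \<in> ell2 G" "ell2_norm G \<delta> \<le> 1"
    using hs by (auto simp: ell2_def ell2_norm_def infsumI intro: has_sum_imp_summable)
  have val: "left_reg G \<alpha> \<delta> h = ?a h" if h: "h \<in> carrier G" for h
  proof -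
    have "left_reg G \<alpha> \<delta> h = (\<Sum>g\<in>?K. if g = h then ?a g else 0)"
      unfolding left_reg_def
    proof (rule sum.cong)
      fix g assume "g \<in> ?K"
      then have g: "g \<in> carrier G" using K by blast
      have "inv g \<otimes> h = \<one> \<longleftrightarrow> g = h"
        using g h by (metis inv_closed inv_inv inv_equality l_inv)
      then show "?a g * \<delta> (inv g \<otimes> h) = (if g = h then ?a g else 0)" by (simp add: \<delta>_def)
    qed simp
    also have "\<dots> = ?a h" by (simp add: in_keys_iff)
    finally show ?thesis .
  qed
  have "(\<Sum>\<^sub>\<infinity>h\<in>carrier G. (cmod (left_reg G \<alpha> \<delta> h))\<^sup>2) = (\<Sum>\<^sub>\<infinity>h\<in>?K. (cmod (?a h))\<^sup>2)"
    by (rule infsum_cong_neutral) (use K val in \<open>auto simp: in_keys_iff\<close>)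
  then have norm: "ell2_norm G (left_reg G \<alpha> \<delta>) = sqrt (\<Sum>g\<in>?K. (cmod (?a g))\<^sup>2)"
    by (simp add: ell2_norm_def)
  have le: "sqrt (\<Sum>g\<in>?K. (cmod (?a g))\<^sup>2) \<le> left_reg_norm G \<alpha>"
    using left_reg_le_norm_unit[OF \<alpha> \<delta>] norm by simp
  have "0 \<le> sqrt (\<Sum>g\<in>?K. (cmod (?a g))\<^sup>2)" by (simp add: sum_nonneg)
  with le show "0 \<le> left_reg_norm G \<alpha>" by linarith
  show "(\<Sum>g\<in>?K. (cmod (?a g))\<^sup>2) \<le> (left_reg_norm G \<alpha>)\<^sup>2"
    using le by (rule sqrt_le_D)
qed

text \<open>Pulling \<open>\<xi>\<close> back along the orbit maps \<open>h \<mapsto> s h j\<close> and summing over \<open>j\<close> counts every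
  point \<open>|G|\<close> times.\<close>

lemma sofic_op_norm_le_left_reg_norm:
  assumes fin: "finite (carrier G)" and \<alpha>: "\<alpha> \<in> group_ring G"
    and perm: "\<And>g. g \<in> carrier G \<Longrightarrow> s g permutes {1..n}"
    and hom: "\<And>g h j. g \<in> carrier G \<Longrightarrow> h \<in> carrier G \<Longrightarrow> j \<in> {1..n} \<Longrightarrow> s (g \<otimes> h) j = s g (s h j)"
  shows "unif_norm2 n (sofic_op s \<alpha> \<xi>) \<le> left_reg_norm G \<alpha> * unif_norm2 n \<xi>"
proof -
  let ?K = "Poly_Mapping.keys \<alpha>" and ?a = "Poly_Mapping.lookup \<alpha>" and ?L = "left_reg_norm G \<alpha>"
  have K: "?K \<subseteq> carrier G" using \<alpha> unfolding group_ring_def by blast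
  define orb where "orb j h = \<xi> (s h j)" for j h
  \<comment> \<open>Since the action is exact, pulling back along an orbit map intertwines
    \<open>sofic_op s \<alpha>\<close> with \<open>left_reg G \<alpha>\<close>.\<close>
  have op: "left_reg G \<alpha> (orb j) h = sofic_op s \<alpha> \<xi> (s h j)"
    if h: "h \<in> carrier G" and j: "j \<in> {1..n}" for h j
    unfolding left_reg_def sofic_op_def
  proof (rule sum.cong)
    fix g assume "g \<in> ?K"
    then have g: "g \<in> carrier G" using K by blast
    have "s g (s (inv g \<otimes> h) j) = s (g \<otimes> (inv g \<otimes> h)) j"
      using g h j by (simp add: hom)
    also have "\<dots> = s h j" using g h by (simp add: m_assoc[symmetric])
    finally have "s (inv g \<otimes> h) j = inv_into UNIV (s g) (s h j)"
      using permutes_inj[OF perm[OF g]] by (metis inv_f_f)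
    then show "?a g * orb j (inv g \<otimes> h) = ?a g * \<xi> (inv_into UNIV (s g) (s h j))"
      by (simp add: orb_def)
  qed simp
  have orbit_sum: "(\<Sum>j\<in>{1..n}. \<Sum>h\<in>carrier G. f (s h j)) = real (order G) * (\<Sum>j\<in>{1..n}. f j)"
    for f :: "nat \<Rightarrow> real"
  proof -
    have "(\<Sum>j\<in>{1..n}. \<Sum>h\<in>carrier G. f (s h j)) = (\<Sum>h\<in>carrier G. \<Sum>j\<in>{1..n}. f (s h j))"
      by (rule sum.swap)
    also have "\<dots> = (\<Sum>h\<in>carrier G. \<Sum>j\<in>{1..n}. f j)"
    proof (rule sum.cong)
      fix h assume "h \<in> carrier G"
      from sum.permute[OF perm[OF this], of f]
      show "(\<Sum>j\<in>{1..n}. f (s h j)) = (\<Sum>j\<in>{1..n}. f j)" by (simp add: o_def)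
    qed simp
    finally show ?thesis by (simp add: order_def)
  qed
  have L0: "0 \<le> ?L" by (rule l2_coeffs_le_left_reg_norm(1)[OF \<alpha>])
  have one: "(\<Sum>h\<in>carrier G. (cmod (sofic_op s \<alpha> \<xi> (s h j)))\<^sup>2) \<le> ?L\<^sup>2 * (\<Sum>h\<in>carrier G. (cmod (\<xi> (s h j)))\<^sup>2)"
    if j: "j \<in> {1..n}" for j
  proof -
    have "orb j \<in> ell2 G" using fin by (simp add: ell2_def)
    from left_reg_le_norm[OF \<alpha> this]
    have "(ell2_norm G (left_reg G \<alpha> (orb j)))\<^sup>2 \<le> (?L * ell2_norm G (orb j))\<^sup>2"
      by (intro power_mono ell2_norm_nonneg)
    moreover have "(ell2_norm G \<zeta>)\<^sup>2 = (\<Sum>h\<in>carrier G. (cmod (\<zeta> h))\<^sup>2)" for \<zeta>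
      using fin by (simp add: ell2_norm_def sum_nonneg)
    ultimately show ?thesis using j by (simp add: op power_mult_distrib orb_def)
  qed
  have "real (order G) * (\<Sum>j\<in>{1..n}. (cmod (sofic_op s \<alpha> \<xi> j))\<^sup>2)
      = (\<Sum>j\<in>{1..n}. \<Sum>h\<in>carrier G. (cmod (sofic_op s \<alpha> \<xi> (s h j)))\<^sup>2)"
    by (rule orbit_sum[symmetric])
  also have "\<dots> \<le> (\<Sum>j\<in>{1..n}. ?L\<^sup>2 * (\<Sum>h\<in>carrier G. (cmod (\<xi> (s h j)))\<^sup>2))"
    by (intro sum_mono one)
  also have "\<dots> = real (order G) * (?L\<^sup>2 * (\<Sum>j\<in>{1..n}. (cmod (\<xi> j))\<^sup>2))"
    by (simp only: sum_distrib_left[symmetric] orbit_sum[of "\<lambda>j. (cmod (\<xi> j))\<^sup>2"] mult.left_commute)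
  finally have "(\<Sum>j\<in>{1..n}. (cmod (sofic_op s \<alpha> \<xi> j))\<^sup>2) \<le> ?L\<^sup>2 * (\<Sum>j\<in>{1..n}. (cmod (\<xi> j))\<^sup>2)"
    using fin order_gt_0_iff_finite by simp
  then have "(\<Sum>j\<in>{1..n}. (cmod (sofic_op s \<alpha> \<xi> j))\<^sup>2) / real n
      \<le> ?L\<^sup>2 * ((\<Sum>j\<in>{1..n}. (cmod (\<xi> j))\<^sup>2) / real n)"
    by (simp add: divide_right_mono)
  then have "unif_norm2 n (sofic_op s \<alpha> \<xi>) \<le> sqrt (?L\<^sup>2 * ((\<Sum>j\<in>{1..n}. (cmod (\<xi> j))\<^sup>2) / real n))"
    unfolding unif_norm2_def by (rule real_sqrt_le_mono)
  also have "\<dots> = ?L * unif_norm2 n \<xi>"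
    using L0 by (simp only: unif_norm2_def real_sqrt_mult real_sqrt_abs abs_of_nonneg)
  finally show ?thesis .
qed

end

section \<open>Colour classes and weak containment\<close>

lemma unif_eq_card: "J \<subseteq> {1..n} \<Longrightarrow> unif n J = real (card J) / real n"
  by (simp add: unif_def measure_uniform_count_measure)

lemma unif_eq_sum: "J \<subseteq> {1..n} \<Longrightarrow> unif n J = (\<Sum>j\<in>{1..n}. indicat_real J j) / real n"
proof -
  assume J: "J \<subseteq> {1..n}"
  then have "(\<Sum>j\<in>{1..n}. indicat_real J j) = (\<Sum>j\<in>J. 1)"
    by (intro sum.mono_neutral_cong_right) auto
  then show ?thesis using J by (simp add: unif_eq_card)
qed

lemma eventually_card_not_le:
  fixes d :: "nat \<Rightarrow> nat"
  assumes lim: "(\<lambda>i. unif (d i) {j\<in>{1..d i}. P i j}) \<longlonglongrightarrow> 1" and "0 < \<theta>"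
  shows "\<forall>\<^sub>F i in sequentially. real (card {j\<in>{1..d i}. \<not> P i j}) \<le> \<theta> * real (d i)"
proof -
  have "\<forall>\<^sub>F i in sequentially. 1 - \<theta> < unif (d i) {j\<in>{1..d i}. P i j}"
    using lim assms(2) by (intro order_tendstoD) auto
  then show ?thesis
  proof (rule eventually_mono)
    fix i assume less: "1 - \<theta> < unif (d i) {j\<in>{1..d i}. P i j}"
    let ?A = "{j\<in>{1..d i}. P i j}" and ?B = "{j\<in>{1..d i}. \<not> P i j}"
    have "card (?A \<union> ?B) = card ?A + card ?B" by (rule card_Un_disjoint) auto
    moreover have "?A \<union> ?B = {1..d i}" by auto
    ultimately have "real (d i) = real (card ?A) + real (card ?B)" by simp
    moreover have "(1 - \<theta>) * real (d i) \<le> real (card ?A)"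
    proof (cases "d i = 0")
      case False
      moreover have "unif (d i) ?A = real (card ?A) / real (d i)" by (rule unif_eq_card) auto
      ultimately show ?thesis using less by (simp add: less_divide_eq)
    qed simp
    ultimately show "real (card ?B) \<le> \<theta> * real (d i)" by (simp add: algebra_simps)
  qed
qed

text \<open>The density of a colour class depends on the colouring, so centring the class also
  subtracts the average of the noise; both summands then have mean zero.\<close>

lemma noise_decomposition:
  assumes "0 < n" and J: "J \<subseteq> {1..n}"
  shows "centered_indicator n {j \<in> J. c j = l} = (\<lambda>j. of_real (1 / real (card B) *
      (indicat_real J j - unif n J) + (noise B l J c j - (\<Sum>j\<in>{1..n}. noise B l J c j) / real n)))"
proof -
  have ind: "indicat_real {j \<in> J. c j = l} j = 1 / real (card B) * indicat_real J j + noise B l J c j" for j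
    by (auto simp: noise_def)
  have "unif n {j \<in> J. c j = l} = (\<Sum>j\<in>{1..n}. indicat_real {j \<in> J. c j = l} j) / real n"
    using J by (intro unif_eq_sum) auto
  also have "\<dots> = 1 / real (card B) * unif n J + (\<Sum>j\<in>{1..n}. noise B l J c j) / real n"
    unfolding ind unif_eq_sum[OF J] sum.distrib sum_distrib_left[symmetric]
    by (simp add: add_divide_distrib)
  finally have u: "unif n {j \<in> J. c j = l}
    = 1 / real (card B) * unif n J + (\<Sum>j\<in>{1..n}. noise B l J c j) / real n" .
  show ?thesis
  proof
    fix j
    have "centered_indicator n {j \<in> J. c j = l} j
        = of_real (indicat_real {j \<in> J. c j = l} j - unif n {j \<in> J. c j = l})"
      by (simp add: centered_indicator_def indicator_def)
    then show "centered_indicator n {j \<in> J. c j = l} j = of_real (1 / real (card B) *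
        (indicat_real J j - unif n J) + (noise B l J c j - (\<Sum>j\<in>{1..n}. noise B l J c j) / real n))"
      unfolding ind u by (simp add: algebra_simps)
  qed
qed

text \<open>For finite q, shrinking the set raises the mean of q-th powers by at most 1/r, and the
  q-th root of 1/r is at most 1/r because r \<le> 1 \<le> q. For q = \<infinity> the maximum only
  decreases. One factor thus serves all q.\<close>

lemma rho_q_subset_le:
  assumes "finite J" and "I \<subseteq> J" and "I \<noteq> {}" and r: "0 < r" "r \<le> 1" "r * real (card J) \<le> real (card I)"
    and "1 \<le> q" and nonneg: "\<And>j. j \<in> J \<Longrightarrow> 0 \<le> \<rho> (\<phi> j) (\<psi> j)"
  shows "rho_q \<rho> q I \<phi> \<psi> \<le> rho_q \<rho> q J \<phi> \<psi> / r"
proof (cases "q = \<infinity>")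
  case True
  let ?M = "\<lambda>I. MAX a\<in>I. \<rho> (\<phi> a) (\<psi> a)"
  have le: "?M I \<le> ?M J" using assms(1-3) by (intro Max_mono) auto
  obtain a where a: "a \<in> J" using assms(2,3) by blast
  then have "\<rho> (\<phi> a) (\<psi> a) \<le> ?M J" using assms(1) by (intro Max_ge) auto
  then have "0 \<le> ?M J" using nonneg[OF a] by linarith
  then have "?M J * r \<le> ?M J * 1" using r by (intro mult_left_mono) auto
  then have "?M J \<le> ?M J / r" using r by (simp add: le_divide_eq)
  with le have "?M I \<le> ?M J / r" by linarith
  then show ?thesis using True a assms(3) by (auto simp: rho_q_def)
next
  case False
  define t where "t = real_of_ereal q"
  have t: "1 \<le> t" using False \<open>1 \<le> q\<close> unfolding t_def by (cases q) auto
  let ?S = "\<lambda>I. \<Sum>a\<in>I. \<rho> (\<phi> a) (\<psi> a) powr t"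
  have cI: "0 < card I" and cJ: "0 < card J"
    using assms(1-3) finite_subset by (auto simp: card_gt_0_iff)
  have "?S I / real (card I) \<le> ?S J / (r * real (card J))"
    using assms(1,2) r cI cJ by (intro frac_le sum_mono2 sum_nonneg) auto
  also have "\<dots> = ?S J / real (card J) / r" by simp
  finally have "(?S I / real (card I)) powr (1 / t) \<le> (?S J / real (card J) / r) powr (1 / t)"
    using t by (intro powr_mono2) (auto intro!: divide_nonneg_nonneg sum_nonneg)
  also have "\<dots> = (?S J / real (card J)) powr (1 / t) / r powr (1 / t)"
    by (rule powr_divide)
  also have "\<dots> \<le> (?S J / real (card J)) powr (1 / t) / r"
  proof (rule divide_left_mono)
    show "r \<le> r powr (1 / t)" using powr_mono'[of "1 / t" 1 r] t r by simp
    show "0 < r powr (1 / t) * r" using r by simp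
  qed simp
  finally show ?thesis using False by (simp add: rho_q_def t_def)
qed

text \<open>All randomness is packed into \<open>vw\<close>, \<open>ow\<close> and
  \<open>ww\<close>. As v has mean zero, centring the noise leaves its correlations with v
  unchanged, while its correlations with itself change by m^2 \<le> \<theta>. Hence the norm
  estimate is applied with 2 \<theta> + \<theta> = 3 \<theta>.\<close>

lemma colour_class_in_Lambda_set:
  fixes s :: "'g \<Rightarrow> nat \<Rightarrow> nat"
  assumes G: "group G" and n: "0 < n" and E: "E \<subseteq> group_ring G"
    and keys: "\<And>\<alpha>. \<alpha> \<in> E \<Longrightarrow> Poly_Mapping.keys \<alpha> \<subseteq> S" and one: "\<one>\<^bsub>G\<^esub> \<in> S"
    and perm: "\<And>g. g \<in> S \<Longrightarrow> s g permutes {1..n}"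
    and J: "J \<in> Lambda_set G E \<eta>' n s"
    and M: "\<And>\<alpha>. \<alpha> \<in> E \<Longrightarrow> left_reg_norm G \<alpha> \<le> M"
      "\<And>\<alpha>. \<alpha> \<in> E \<Longrightarrow> (\<Sum>g\<in>Poly_Mapping.keys \<alpha>. cmod (Poly_Mapping.lookup \<alpha> g)) \<le> M" "1 \<le> M"
    and "0 < \<eta>" and \<eta>': "0 \<le> \<eta>'" "\<eta>' \<le> 1" "3 * M * \<eta>' \<le> \<eta>\<^sup>2 / 2"
    and \<theta>: "0 \<le> \<theta>" "\<theta> \<le> 1" "5 * M\<^sup>2 * (3 * \<theta>) \<le> \<eta>\<^sup>2 / 2"
    and vw: "\<And>g h. g \<in> S \<Longrightarrow> h \<in> S \<Longrightarrow>
      \<bar>corr n (inv_into UNIV (s g)) (inv_into UNIV (s h)) (\<lambda>j. indicat_real J j - unif n J) (noise B l J c)\<bar> \<le> \<theta>"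
    and ow: "\<And>g h. g \<in> S \<Longrightarrow> h \<in> S \<Longrightarrow>
      \<bar>corr n (inv_into UNIV (s g)) (inv_into UNIV (s h)) (\<lambda>j. 1) (noise B l J c)\<bar> \<le> \<theta>"
    and ww: "\<And>g h. g \<in> S \<Longrightarrow> h \<in> S \<Longrightarrow> g \<noteq> h \<Longrightarrow>
      \<bar>corr n (inv_into UNIV (s g)) (inv_into UNIV (s h)) (noise B l J c) (noise B l J c)\<bar> \<le> 2 * \<theta>"
  shows "{j \<in> J. c j = l} \<in> Lambda_set G E \<eta> n s"
proof -
  interpret group G by (rule G)
  let ?\<tau> = "\<lambda>g. inv_into UNIV (s g)"
  let ?w = "noise B l J c"
  define v where "v j = indicat_real J j - unif n J" for j
  define m where "m = (\<Sum>j\<in>{1..n}. ?w j) / real n"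
  define z where "z j = ?w j + - m" for j
  have J_sub: "J \<subseteq> {1..n}" using J by (simp add: Lambda_set_def)
  have perm': "?\<tau> g permutes {1..n}" if "g \<in> S" for g
    using permutes_inv[OF perm[OF that]] .
  have uJ: "0 \<le> unif n J" "unif n J \<le> 1"
    using card_mono[OF _ J_sub] n by (auto simp: unif_eq_card[OF J_sub])
  have v1: "\<bar>v j\<bar> \<le> 1" for j using uJ by (auto simp: v_def indicator_def)
  have v0: "(\<Sum>j\<in>{1..n}. v j) = 0"
    using n by (simp add: v_def sum_subtractf unif_eq_sum[OF J_sub])
  \<comment> \<open>The average of the noise is its correlation with the constant 1, which is what
    \<open>ow\<close> is for.\<close>
  have m: "\<bar>m\<bar> \<le> \<theta>"
    using ow[OF one one] corr_const_left[OF perm'[OF one], of "?\<tau> \<one>\<^bsub>G\<^esub>" 1 ?w] by (simp add: m_def)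
  have vz: "corr n (?\<tau> g) (?\<tau> h) v z = corr n (?\<tau> g) (?\<tau> h) v ?w" if "g \<in> S" "h \<in> S" for g h
    unfolding z_def corr_add_right
    using corr_const_left[OF perm'[OF that(1)], of "?\<tau> h" "- m" v] v0
    by (simp add: corr_commute[of n "?\<tau> g" "?\<tau> h" v "\<lambda>j. - m"])
  have zz: "\<bar>corr n (?\<tau> g) (?\<tau> h) z z\<bar> \<le> 3 * \<theta>" if "g \<in> S" "h \<in> S" "g \<noteq> h" for g h
  proof -
    have "corr n (?\<tau> g) (?\<tau> h) (\<lambda>j. - m) ?w = - m * m"
      using corr_const_left[OF perm'[OF that(2)], of "?\<tau> g" "- m" ?w] by (simp add: m_def)
    moreover have "corr n (?\<tau> g) (?\<tau> h) ?w (\<lambda>j. - m) = - m * m"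
      unfolding corr_commute[of n "?\<tau> g"]
      using corr_const_left[OF perm'[OF that(1)], of "?\<tau> h" "- m" ?w] by (simp add: m_def)
    moreover have "corr n (?\<tau> g) (?\<tau> h) (\<lambda>j. - m) (\<lambda>j. - m) = m * m"
      using n by (simp add: corr_def)
    ultimately have "corr n (?\<tau> g) (?\<tau> h) z z = corr n (?\<tau> g) (?\<tau> h) ?w ?w - m * m"
      unfolding z_def corr_add_right corr_add_left by simp
    moreover have "\<bar>m * m\<bar> \<le> \<theta>"
      using m \<theta> mult_mono[of "\<bar>m\<bar>" \<theta> "\<bar>m\<bar>" 1] by (simp add: abs_mult)
    ultimately show ?thesis using ww[OF that] by linarith
  qed
  have "unif_norm2 n (sofic_op s \<alpha> (centered_indicator n {j \<in> J. c j = l}))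
      \<le> left_reg_norm G \<alpha> * unif_norm2 n (centered_indicator n {j \<in> J. c j = l}) + \<eta>" if \<alpha>: "\<alpha> \<in> E" for \<alpha>
  proof -
    have \<alpha>': "\<alpha> \<in> group_ring G" using \<alpha> E by blast
    have in_S: "g \<in> S" if "g \<in> Poly_Mapping.keys \<alpha>" for g using keys[OF \<alpha>] that by blast
    have cJ: "centered_indicator n J = (\<lambda>j. of_real (v j))"
      by (auto simp: centered_indicator_def v_def indicator_def)
    have eq: "centered_indicator n {j \<in> J. c j = l} = (\<lambda>j. of_real (1 / real (card B) * v j + z j))"
      unfolding noise_decomposition[OF n J_sub, of c l B] v_def z_def m_def by simp
    have vw': "\<bar>corr n (?\<tau> g) (?\<tau> h) v z\<bar> \<le> 3 * \<theta>" if "g \<in> S" "h \<in> S" for g h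
      unfolding vz[OF that] unfolding v_def[abs_def] using vw[OF that] \<theta> by linarith
    show ?thesis unfolding eq
    proof (rule sofic_op_norm_le[where M = M and \<eta>' = \<eta>' and \<theta> = "3 * \<theta>"])
      show "1 / real (card B) \<le> 1" by (cases "card B = 0") auto
      show "unif_norm2 n (sofic_op s \<alpha> (\<lambda>j. of_real (v j)))
          \<le> left_reg_norm G \<alpha> * unif_norm2 n (\<lambda>j. of_real (v j)) + \<eta>'"
        using J \<alpha> by (simp only: Lambda_set_def mem_Collect_eq cJ[symmetric])
      \<comment> \<open>The permutation of the neutral element need not be the identity, but
        displacing both functions by the same permutation preserves their correlation.\<close>
      show "\<bar>corr n id id v z\<bar> \<le> 3 * \<theta>"
        using vw'[OF one one] by (simp only: corr_permutes_same[OF perm'[OF one], of v z])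
      show "\<bar>corr n (?\<tau> g) (?\<tau> h) v z\<bar> \<le> 3 * \<theta>"
        if "g \<in> Poly_Mapping.keys \<alpha>" "h \<in> Poly_Mapping.keys \<alpha>" for g h
        by (rule vw'[OF in_S in_S, OF that])
    qed (use n perm' in_S l2_coeffs_le_left_reg_norm[OF \<alpha>'] v1 zz M \<alpha> \<open>0 < \<eta>\<close> \<eta>' \<theta> in auto)
  qed
  then show ?thesis using J_sub by (auto simp: Lambda_set_def)
qed

text \<open>Union bound over the triples (l, g, h): with P the set of colourings, three events of at
  most 2 |P| / (n \<theta>^2) colourings each give at most 6 |B| |S|^2 |P| / (n \<theta>^2) bad
  ones. The 12 in \<open>large\<close> makes this at most |P| / 2.\<close>

lemma half_of_colourings:
  fixes s :: "'g \<Rightarrow> nat \<Rightarrow> nat"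
  assumes G: "group G" and n: "0 < n" and E: "E \<subseteq> group_ring G"
    and S: "finite S" "\<one>\<^bsub>G\<^esub> \<in> S" and keys: "\<And>\<alpha>. \<alpha> \<in> E \<Longrightarrow> Poly_Mapping.keys \<alpha> \<subseteq> S"
    and perm: "\<And>g. g \<in> S \<Longrightarrow> s g permutes {1..n}"
    and J: "J \<in> Lambda_set G E \<eta>' n s"
    and M: "\<And>\<alpha>. \<alpha> \<in> E \<Longrightarrow> left_reg_norm G \<alpha> \<le> M"
      "\<And>\<alpha>. \<alpha> \<in> E \<Longrightarrow> (\<Sum>g\<in>Poly_Mapping.keys \<alpha>. cmod (Poly_Mapping.lookup \<alpha> g)) \<le> M" "1 \<le> M"
    and "0 < \<eta>" and \<eta>': "0 \<le> \<eta>'" "\<eta>' \<le> 1" "3 * M * \<eta>' \<le> \<eta>\<^sup>2 / 2"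
    and \<theta>: "0 < \<theta>" "\<theta> \<le> 1" "5 * M\<^sup>2 * (3 * \<theta>) \<le> \<eta>\<^sup>2 / 2"
    and B: "finite B"
    and few: "\<And>g h. g \<in> S \<Longrightarrow> h \<in> S \<Longrightarrow> g \<noteq> h \<Longrightarrow>
      real (card {j\<in>{1..n}. s g j = s h j}) \<le> \<theta> * real n"
    and large: "12 * real (card B) * (real (card S))\<^sup>2 \<le> real n * \<theta>\<^sup>2"
  shows "real (card (J \<rightarrow>\<^sub>E B))
    \<le> 2 * real (card {c\<in>J \<rightarrow>\<^sub>E B. \<forall>l\<in>B. {j \<in> J. c j = l} \<in> Lambda_set G E \<eta> n s})"
proof -
  interpret group G by (rule G)
  let ?\<tau> = "\<lambda>g. inv_into UNIV (s g)"
  let ?w = "\<lambda>l c. noise B l J c"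
  let ?P = "J \<rightarrow>\<^sub>E B"
  let ?good = "{c\<in>?P. \<forall>l\<in>B. {j \<in> J. c j = l} \<in> Lambda_set G E \<eta> n s}"
  have J_sub: "J \<subseteq> {1..n}" using J by (simp add: Lambda_set_def)
  then have finJ: "finite J" by (rule finite_subset) simp
  have finP: "finite ?P" using finJ B by (simp add: finite_PiE)
  have perm': "?\<tau> g permutes {1..n}" if "g \<in> S" for g
    using permutes_inv[OF perm[OF that]] .
  have inj: "inj_on (?\<tau> g) {1..n}" if "g \<in> S" for g
    using permutes_inj_on[OF perm'[OF that]] .
  \<comment> \<open>\<open>few\<close> concerns the permutations, \<open>sofic_op\<close> their
    inverses. The inverse of \<open>s g\<close> carries coincidences of the inverses injectively to
    coincidences of the permutations.\<close>
  have few': "real (card {j\<in>{1..n}. ?\<tau> g j = ?\<tau> h j}) \<le> \<theta> * real n"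
    if gh: "g \<in> S" "h \<in> S" "g \<noteq> h" for g h
  proof -
    have "?\<tau> g ` {j\<in>{1..n}. ?\<tau> g j = ?\<tau> h j} \<subseteq> {j\<in>{1..n}. s g j = s h j}"
    proof safe
      fix j assume j: "j \<in> {1..n}" "?\<tau> g j = ?\<tau> h j"
      show "?\<tau> g j \<in> {1..n}" using permutes_in_image[OF perm'[OF gh(1)]] j(1) by blast
      have "s g (?\<tau> g j) = j" "s h (?\<tau> h j) = j"
        using permutes_inverses(1)[OF perm[OF gh(1)]] permutes_inverses(1)[OF perm[OF gh(2)]] by auto
      then show "s g (?\<tau> g j) = s h (?\<tau> g j)" using j(2) by simp
    qed
    then have "card {j\<in>{1..n}. ?\<tau> g j = ?\<tau> h j} \<le> card {j\<in>{1..n}. s g j = s h j}"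
      by (intro card_inj_on_le[where f = "?\<tau> g"] inj_on_subset[OF inj[OF gh(1)]]) auto
    then show ?thesis using few[OF gh] by linarith
  qed
  define bad1 where "bad1 l g h = {c\<in>?P. \<theta> < \<bar>corr n (?\<tau> g) (?\<tau> h) (\<lambda>j. indicat_real J j - unif n J) (?w l c)\<bar>}" for l g h
  define bad2 where "bad2 l g h = {c\<in>?P. \<theta> < \<bar>corr n (?\<tau> g) (?\<tau> h) (\<lambda>j. 1) (?w l c)\<bar>}" for l g h
  \<comment> \<open>For g = h the correlation is the squared norm of the noise, which need not be
    small; nothing is excluded there.\<close>
  define bad3 where "bad3 l g h = (if g = h then {} else
    {c\<in>?P. 2 * \<theta> < \<bar>corr n (?\<tau> g) (?\<tau> h) (?w l c) (?w l c)\<bar>})" for l g h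
  define bad where "bad = (\<Union>(l, g, h)\<in>B \<times> S \<times> S. bad1 l g h \<union> bad2 l g h \<union> bad3 l g h)"
  let ?b = "2 * real (card ?P) / (real n * \<theta>\<^sup>2)"
  have b0: "0 \<le> ?b" using n by simp
  have uJ: "0 \<le> unif n J" "unif n J \<le> 1"
    using card_mono[OF _ J_sub] n by (auto simp: unif_eq_card[OF J_sub])
  have v1: "\<bar>indicat_real J j - unif n J\<bar> \<le> 1" for j using uJ by (auto simp: indicator_def)
  have one: "real (card (bad1 l g h \<union> bad2 l g h \<union> bad3 l g h)) \<le> 3 * ?b"
    if lgh: "l \<in> B" "g \<in> S" "h \<in> S" for l g h
  proof -
    have "real (card (bad1 l g h)) \<le> ?b" unfolding bad1_def
      by (rule card_linear_deviation_le[OF B lgh(1) finJ n \<theta>(1) inj[OF lgh(3)] v1])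
    moreover have "real (card (bad2 l g h)) \<le> ?b" unfolding bad2_def
      by (rule card_linear_deviation_le[OF B lgh(1) finJ n \<theta>(1) inj[OF lgh(3)]]) simp
    moreover have "real (card (bad3 l g h)) \<le> ?b"
    proof (cases "g = h")
      case False
      then show ?thesis unfolding bad3_def
        using card_quadratic_deviation_le[OF B lgh(1) finJ n \<theta>(1) inj[OF lgh(2)] inj[OF lgh(3)]
            few'[OF lgh(2,3)]] by simp
    qed (use b0 in \<open>simp add: bad3_def\<close>)
    moreover have "card (bad1 l g h \<union> bad2 l g h \<union> bad3 l g h)
        \<le> card (bad1 l g h) + card (bad2 l g h) + card (bad3 l g h)"
      using card_Un_le[of "bad1 l g h \<union> bad2 l g h" "bad3 l g h"]
        card_Un_le[of "bad1 l g h" "bad2 l g h"] by linarith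
    ultimately show ?thesis by linarith
  qed
  have "card bad \<le> (\<Sum>x\<in>B \<times> S \<times> S. card (case x of (l, g, h) \<Rightarrow> bad1 l g h \<union> bad2 l g h \<union> bad3 l g h))"
    unfolding bad_def using B S by (intro card_UN_le) simp
  then have "real (card bad)
      \<le> (\<Sum>x\<in>B \<times> S \<times> S. real (card (case x of (l, g, h) \<Rightarrow> bad1 l g h \<union> bad2 l g h \<union> bad3 l g h)))"
    by (simp flip: of_nat_sum)
  also have "\<dots> \<le> (\<Sum>x\<in>B \<times> S \<times> S. 3 * ?b)"
  proof (rule sum_mono)
    fix x assume "x \<in> B \<times> S \<times> S"
    then obtain l g h where "x = (l, g, h)" "l \<in> B" "g \<in> S" "h \<in> S" by blast
    then show "real (card (case x of (l, g, h) \<Rightarrow> bad1 l g h \<union> bad2 l g h \<union> bad3 l g h)) \<le> 3 * ?b"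
      using one by simp
  qed
  also have "\<dots> = 12 * real (card B) * (real (card S))\<^sup>2 * (real (card ?P) / (2 * (real n * \<theta>\<^sup>2)))"
    by (simp add: card_cartesian_product power2_eq_square mult_ac)
  also have "\<dots> \<le> real n * \<theta>\<^sup>2 * (real (card ?P) / (2 * (real n * \<theta>\<^sup>2)))"
    using large by (intro mult_right_mono) auto
  also have "\<dots> = real (card ?P) / 2" using n \<theta>(1) by simp
  finally have bad_le: "real (card bad) \<le> real (card ?P) / 2" .
  have "?P - bad \<subseteq> ?good"
  proof safe
    fix c l assume c: "c \<in> ?P" "c \<notin> bad" and l: "l \<in> B"
    have nb: "c \<notin> bad1 l g h" "c \<notin> bad2 l g h" "c \<notin> bad3 l g h" if "g \<in> S" "h \<in> S" for g h
      using c(2) l that unfolding bad_def by auto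
    show "{j \<in> J. c j = l} \<in> Lambda_set G E \<eta> n s"
    proof (rule colour_class_in_Lambda_set[OF G n E keys S(2) perm J M \<open>0 < \<eta>\<close> \<eta>' _ \<theta>(2,3)])
      show "\<bar>corr n (?\<tau> g) (?\<tau> h) (\<lambda>j. indicat_real J j - unif n J) (?w l c)\<bar> \<le> \<theta>"
        if "g \<in> S" "h \<in> S" for g h
        using nb(1)[OF that] c(1) unfolding bad1_def by (simp add: not_less)
      show "\<bar>corr n (?\<tau> g) (?\<tau> h) (\<lambda>j. 1) (?w l c)\<bar> \<le> \<theta>" if "g \<in> S" "h \<in> S" for g h
        using nb(2)[OF that] c(1) unfolding bad2_def by (simp add: not_less)
      show "\<bar>corr n (?\<tau> g) (?\<tau> h) (?w l c) (?w l c)\<bar> \<le> 2 * \<theta>" if "g \<in> S" "h \<in> S" "g \<noteq> h" for g h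
        using nb(3)[OF that(1,2)] c(1) that(3) unfolding bad3_def by (simp add: not_less)
    qed (use \<theta> in auto)
  qed
  then have "card (?P - bad) \<le> card ?good" using finP by (intro card_mono) auto
  moreover have bad_sub: "bad \<subseteq> ?P"
    by (auto simp: bad_def bad1_def bad2_def bad3_def split: if_splits)
  moreover have "card (?P - bad) = card ?P - card bad"
    using bad_sub finite_subset[OF bad_sub finP] by (intro card_Diff_subset)
  moreover have "card bad \<le> card ?P" using finP bad_sub by (rule card_mono)
  ultimately have "real (card ?P) - real (card bad) \<le> real (card ?good)" by linarith
  then show ?thesis using bad_le by linarith
qed

section \<open>Consequences of soficity for late indices\<close>

context group
begin

lemma sofic_permutes:
  "sofic_approximation G d \<sigma> \<Longrightarrow> g \<in> carrier G \<Longrightarrow> \<sigma> i g permutes {1..d i}"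
  by (simp add: sofic_approximation_def)

lemma sofic_almost_hom:
  assumes "sofic_approximation G d \<sigma>" and "g \<in> carrier G" and "h \<in> carrier G" and "0 < \<theta>"
  shows "\<forall>\<^sub>F i in sequentially.
    real (card {j\<in>{1..d i}. \<sigma> i (g \<otimes> h) j \<noteq> \<sigma> i g (\<sigma> i h j)}) \<le> \<theta> * real (d i)"
proof (rule eventually_card_not_le)
  show "(\<lambda>i. unif (d i) {j\<in>{1..d i}. \<sigma> i (g \<otimes> h) j = \<sigma> i g (\<sigma> i h j)}) \<longlonglongrightarrow> 1"
    using assms(1-3) unfolding sofic_approximation_def by blast
qed (rule assms(4))

lemma sofic_almost_free:
  assumes "sofic_approximation G d \<sigma>" and "g \<in> carrier G" and "g \<noteq> \<one>" and "0 < \<theta>"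
  shows "\<forall>\<^sub>F i in sequentially. real (card {j\<in>{1..d i}. \<sigma> i g j = j}) \<le> \<theta> * real (d i)"
proof -
  have "(\<lambda>i. unif (d i) {j\<in>{1..d i}. \<sigma> i g j \<noteq> j}) \<longlonglongrightarrow> 1"
    using assms(1-3) unfolding sofic_approximation_def by blast
  from eventually_card_not_le[OF this assms(4)] show ?thesis by simp
qed

text \<open>If \<sigma>(g) j = \<sigma>(h) j, then away from three small sets where multiplicativity
  fails, \<sigma>(h^-1 g) j = \<sigma>(h^-1 h) j = \<sigma>(e) j = j, and h^-1 g rarely fixes a
  point. Each of the four exceptional sets gets \<theta> / 4.\<close>

lemma sofic_coincidence:
  assumes sof: "sofic_approximation G d \<sigma>" and gh: "g \<in> carrier G" "h \<in> carrier G" "g \<noteq> h"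
    and \<theta>: "0 < \<theta>"
  shows "\<forall>\<^sub>F i in sequentially. real (card {j\<in>{1..d i}. \<sigma> i g j = \<sigma> i h j}) \<le> \<theta> * real (d i)"
proof -
  have \<theta>4: "0 < \<theta> / 4" using \<theta> by simp
  have ne: "inv h \<otimes> g \<noteq> \<one>"
    using gh by (metis inv_closed inv_equality inv_inv)
  have mem: "inv h \<in> carrier G" "inv h \<otimes> g \<in> carrier G" using gh by auto
  note ev = sofic_almost_hom[OF sof mem(1) gh(1) \<theta>4] sofic_almost_hom[OF sof mem(1) gh(2) \<theta>4]
    sofic_almost_hom[OF sof one_closed one_closed \<theta>4] sofic_almost_free[OF sof mem(2) ne \<theta>4]
  show ?thesis using ev
  proof eventually_elim
    case (elim i)
    let ?Z1 = "{j\<in>{1..d i}. \<sigma> i (inv h \<otimes> g) j \<noteq> \<sigma> i (inv h) (\<sigma> i g j)}"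
    let ?Z2 = "{j\<in>{1..d i}. \<sigma> i (inv h \<otimes> h) j \<noteq> \<sigma> i (inv h) (\<sigma> i h j)}"
    let ?Z3 = "{j\<in>{1..d i}. \<sigma> i (\<one> \<otimes> \<one>) j \<noteq> \<sigma> i \<one> (\<sigma> i \<one> j)}"
    let ?Z4 = "{j\<in>{1..d i}. \<sigma> i (inv h \<otimes> g) j = j}"
    have "{j\<in>{1..d i}. \<sigma> i g j = \<sigma> i h j} \<subseteq> ?Z1 \<union> (?Z2 \<union> (?Z3 \<union> ?Z4))"
    proof
      fix j assume j: "j \<in> {j\<in>{1..d i}. \<sigma> i g j = \<sigma> i h j}"
      show "j \<in> ?Z1 \<union> (?Z2 \<union> (?Z3 \<union> ?Z4))"
      proof (rule ccontr)
        assume "j \<notin> ?Z1 \<union> (?Z2 \<union> (?Z3 \<union> ?Z4))"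
        with j have n: "\<sigma> i (inv h \<otimes> g) j = \<sigma> i (inv h) (\<sigma> i g j)"
          "\<sigma> i \<one> j = \<sigma> i (inv h) (\<sigma> i h j)" "\<sigma> i \<one> j = \<sigma> i \<one> (\<sigma> i \<one> j)"
          "\<sigma> i (inv h \<otimes> g) j \<noteq> j" "\<sigma> i g j = \<sigma> i h j"
          using gh by auto
        \<comment> \<open>\<open>sofic_approximation\<close> does not prescribe the value at the
          neutral element; idempotence at j and injectivity force a fixed point.\<close>
        have "\<sigma> i \<one> j = j"
          using injD[OF permutes_inj[OF sofic_permutes[OF sof one_closed, of i]] n(3)] by simp
        with n show False by simp
      qed
    qed
    then have "card {j\<in>{1..d i}. \<sigma> i g j = \<sigma> i h j} \<le> card (?Z1 \<union> (?Z2 \<union> (?Z3 \<union> ?Z4)))"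
      by (intro card_mono) auto
    also have "\<dots> \<le> card ?Z1 + (card ?Z2 + (card ?Z3 + card ?Z4))"
      by (intro order_trans[OF card_Un_le] add_left_mono card_Un_le)
    finally have le: "card {j\<in>{1..d i}. \<sigma> i g j = \<sigma> i h j}
        \<le> card ?Z1 + (card ?Z2 + (card ?Z3 + card ?Z4))" .
    have "real (card {j\<in>{1..d i}. \<sigma> i g j = \<sigma> i h j})
        \<le> real (card ?Z1) + (real (card ?Z2) + (real (card ?Z3) + real (card ?Z4)))"
      using of_nat_mono[OF le, where 'a = real] by (simp only: of_nat_add)
    then show ?case using elim by linarith
  qed
qed

text \<open>For N group elements, the coincidence sets of the |D| pairs cover at most the proportion
  |D| / (|D| + 1) of the points, so some point has N distinct images.\<close>

lemma sofic_degree_unbounded: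
  assumes sof: "sofic_approximation G d \<sigma>" and inf: "infinite (carrier G)"
  shows "\<forall>\<^sub>F i in sequentially. N \<le> d i"
proof -
  obtain S where S: "S \<subseteq> carrier G" "finite S" "card S = N"
    using infinite_arbitrarily_large[OF inf] by blast
  define D where "D = {(g, h) \<in> S \<times> S. g \<noteq> h}"
  have finD: "finite D" unfolding D_def using S(2) by (auto intro: finite_subset[of _ "S \<times> S"])
  define \<theta> where "\<theta> = 1 / (real (card D) + 1)"
  have \<theta>: "0 < \<theta>" by (simp add: \<theta>_def)
  have "\<forall>\<^sub>F i in sequentially. \<forall>x\<in>D.
      real (card {j\<in>{1..d i}. \<sigma> i (fst x) j = \<sigma> i (snd x) j}) \<le> \<theta> * real (d i)"
    using S(1) by (intro eventually_ball_finite finD ballI sofic_coincidence[OF sof _ _ _ \<theta>]) (auto simp: D_def)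
  then show ?thesis
  proof eventually_elim
    case (elim i)
    have d1: "1 \<le> d i" using sof by (simp add: sofic_approximation_def)
    let ?Z = "\<lambda>x. {j\<in>{1..d i}. \<sigma> i (fst x) j = \<sigma> i (snd x) j}"
    have "real (card (\<Union>x\<in>D. ?Z x)) \<le> real (\<Sum>x\<in>D. card (?Z x))"
      by (intro of_nat_mono card_UN_le finD)
    also have "\<dots> = (\<Sum>x\<in>D. real (card (?Z x)))" by simp
    also have "\<dots> \<le> (\<Sum>x\<in>D. \<theta> * real (d i))" using elim by (intro sum_mono) blast
    also have "\<dots> = (real (card D) / (real (card D) + 1)) * real (d i)" by (simp add: \<theta>_def)
    also have "\<dots> < 1 * real (d i)" using d1 by (intro mult_strict_right_mono) auto
    finally have "card (\<Union>x\<in>D. ?Z x) < card {1..d i}" by simp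
    moreover have "finite (\<Union>x\<in>D. ?Z x)" using finD by (intro finite_UN_I) auto
    ultimately have "\<not> {1..d i} \<subseteq> (\<Union>x\<in>D. ?Z x)" using card_mono leD by blast
    then obtain j where j: "j \<in> {1..d i}" "\<And>x. x \<in> D \<Longrightarrow> j \<notin> ?Z x" by blast
    have "inj_on (\<lambda>g. \<sigma> i g j) S"
    proof (rule inj_onI, rule ccontr)
      fix g h assume "g \<in> S" "h \<in> S" "\<sigma> i g j = \<sigma> i h j" "g \<noteq> h"
      then show False using j(2)[of "(g, h)"] j(1) by (simp add: D_def)
    qed
    moreover have "(\<lambda>g. \<sigma> i g j) ` S \<subseteq> {1..d i}"
    proof
      fix y assume "y \<in> (\<lambda>g. \<sigma> i g j) ` S"
      then obtain g where g: "g \<in> S" "y = \<sigma> i g j" by blast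
      then have "\<sigma> i g permutes {1..d i}" using S(1) sofic_permutes[OF sof] by blast
      then show "y \<in> {1..d i}" using g(2) j(1) permutes_in_image by metis
    qed
    ultimately have "card S \<le> card {1..d i}" by (intro card_inj_on_le) auto
    then show ?case using S(3) by simp
  qed
qed

text \<open>For small \<open>d i\<close> the group is finite and \<open>\<sigma> i\<close> is eventually an honest action, so that the
  weak containment condition is vacuous.\<close>

lemma Lambda_set_of_bounded_degree:
  assumes sof: "sofic_approximation G d \<sigma>"
  shows "\<forall>\<^sub>F i in sequentially. d i < N \<longrightarrow>
    (\<forall>E \<eta> J. E \<subseteq> group_ring G \<longrightarrow> 0 \<le> \<eta> \<longrightarrow> J \<subseteq> {1..d i} \<longrightarrow> J \<in> Lambda_set G E \<eta> (d i) (\<sigma> i))"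
proof (cases "finite (carrier G)")
  case False
  show ?thesis using sofic_degree_unbounded[OF sof False, of N] by eventually_elim auto
next
  case fin: True
  \<comment> \<open>If d i < N, an exceptional set of proportion at most \<theta> has less than one
    point, so multiplicativity holds exactly. Finiteness of the group handles all pairs at
    once.\<close>
  define \<theta> where "\<theta> = 1 / (real N + 1)"
  have \<theta>: "0 < \<theta>" by (simp add: \<theta>_def)
  have "\<forall>\<^sub>F i in sequentially. \<forall>g\<in>carrier G. \<forall>h\<in>carrier G.
      real (card {j\<in>{1..d i}. \<sigma> i (g \<otimes> h) j \<noteq> \<sigma> i g (\<sigma> i h j)}) \<le> \<theta> * real (d i)"
    by (intro eventually_ball_finite fin ballI sofic_almost_hom[OF sof _ _ \<theta>])
  then show ?thesis
  proof eventually_elim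
    case (elim i)
    show ?case
    proof (intro impI allI)
      fix E \<eta> J
      assume dN: "d i < N" and E: "E \<subseteq> group_ring G" and \<eta>: "0 \<le> (\<eta>::real)" and J: "J \<subseteq> {1..d i}"
      have hom: "\<sigma> i (g \<otimes> h) j = \<sigma> i g (\<sigma> i h j)"
        if "g \<in> carrier G" "h \<in> carrier G" "j \<in> {1..d i}" for g h j
      proof -
        let ?Z = "{j\<in>{1..d i}. \<sigma> i (g \<otimes> h) j \<noteq> \<sigma> i g (\<sigma> i h j)}"
        have "real (card ?Z) \<le> \<theta> * real (d i)" using elim that by blast
        also have "\<dots> < 1" using dN by (simp add: \<theta>_def)
        finally have "card ?Z = 0" by simp
        then have "?Z = {}" by simp
        then show ?thesis using that(3) by blast
      qed
      have "unif_norm2 (d i) (sofic_op (\<sigma> i) \<alpha> \<xi>) \<le> left_reg_norm G \<alpha> * unif_norm2 (d i) \<xi> + \<eta>"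
        if "\<alpha> \<in> E" for \<alpha> \<xi>
      proof -
        have "\<alpha> \<in> group_ring G" using that E by blast
        from sofic_op_norm_le_left_reg_norm[where s = "\<sigma> i" and n = "d i", OF fin this sofic_permutes[OF sof] hom]
        show ?thesis using \<eta> by (smt (verit))
      qed
      then show "J \<in> Lambda_set G E \<eta> (d i) (\<sigma> i)" using J by (simp add: Lambda_set_def)
    qed
  qed
qed

text \<open>\<open>Lambda_seq\<close> admits every tolerance, so J i may be taken to satisfy weak
  containment with an \<eta>' far smaller than the \<eta> asked of its classes. The premise N \<le>
  d i stays under the quantifier because the degrees may remain bounded.\<close>

lemma eventually_half_of_colourings:
  assumes sof: "sofic_approximation G d \<sigma>" and J: "J \<in> Lambda_seq G d \<sigma>"
    and E: "finite E" "E \<subseteq> group_ring G" and "0 < \<eta>" and B: "finite B"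
  shows "\<exists>N. \<forall>\<^sub>F i in sequentially. N \<le> d i \<longrightarrow> real (card (J i \<rightarrow>\<^sub>E B))
    \<le> 2 * real (card {c\<in>J i \<rightarrow>\<^sub>E B. \<forall>l\<in>B. {j \<in> J i. c j = l} \<in> Lambda_set G E \<eta> (d i) (\<sigma> i)})"
proof -
  let ?A = "\<lambda>\<alpha>. \<Sum>g\<in>Poly_Mapping.keys \<alpha>. cmod (Poly_Mapping.lookup \<alpha> g)"
  define M where "M = 1 + (\<Sum>\<alpha>\<in>E. left_reg_norm G \<alpha> + ?A \<alpha>)"
  have L0: "0 \<le> left_reg_norm G \<alpha>" if "\<alpha> \<in> E" for \<alpha>
    using l2_coeffs_le_left_reg_norm(1) E(2) that by blast
  have A0: "0 \<le> ?A \<alpha>" for \<alpha> by (simp add: sum_nonneg)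
  have sum0: "0 \<le> (\<Sum>\<alpha>\<in>E. left_reg_norm G \<alpha> + ?A \<alpha>)"
    by (intro sum_nonneg add_nonneg_nonneg L0 A0)
  have M: "left_reg_norm G \<alpha> \<le> M" "?A \<alpha> \<le> M" if "\<alpha> \<in> E" for \<alpha>
  proof -
    have "left_reg_norm G \<alpha> + ?A \<alpha> \<le> (\<Sum>\<alpha>\<in>E. left_reg_norm G \<alpha> + ?A \<alpha>)"
      by (rule member_le_sum[OF that _ E(1)]) (intro add_nonneg_nonneg L0 A0, blast)
    then show "left_reg_norm G \<alpha> \<le> M" "?A \<alpha> \<le> M"
      using L0[OF that] A0[of \<alpha>] unfolding M_def by linarith+
  qed
  have M1: "1 \<le> M" using sum0 by (simp add: M_def)
  \<comment> \<open>The denominators 6 M and 30 M^2 are chosen to give 3 M \<eta>' \<le> \<eta>^2 /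
    2 and 15 M^2 \<theta> \<le> \<eta>^2 / 2.\<close>
  define \<eta>' where "\<eta>' = min 1 (\<eta>\<^sup>2 / (6 * M))"
  define \<theta> where "\<theta> = min 1 (\<eta>\<^sup>2 / (30 * M\<^sup>2))"
  have \<eta>': "0 < \<eta>'" "\<eta>' \<le> 1" "3 * M * \<eta>' \<le> \<eta>\<^sup>2 / 2"
  proof -
    show "0 < \<eta>'" "\<eta>' \<le> 1" using M1 \<open>0 < \<eta>\<close> by (auto simp: \<eta>'_def)
    have "3 * M * \<eta>' \<le> 3 * M * (\<eta>\<^sup>2 / (6 * M))"
      using M1 by (intro mult_left_mono) (auto simp: \<eta>'_def)
    then show "3 * M * \<eta>' \<le> \<eta>\<^sup>2 / 2" using M1 by simp
  qed
  have \<theta>: "0 < \<theta>" "\<theta> \<le> 1" "5 * M\<^sup>2 * (3 * \<theta>) \<le> \<eta>\<^sup>2 / 2"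
  proof -
    show "0 < \<theta>" "\<theta> \<le> 1" using M1 \<open>0 < \<eta>\<close> by (auto simp: \<theta>_def)
    have "15 * M\<^sup>2 * \<theta> \<le> 15 * M\<^sup>2 * (\<eta>\<^sup>2 / (30 * M\<^sup>2))"
      by (intro mult_left_mono) (auto simp: \<theta>_def)
    then show "5 * M\<^sup>2 * (3 * \<theta>) \<le> \<eta>\<^sup>2 / 2" using M1 by simp
  qed
  define S where "S = insert \<one> (\<Union>\<alpha>\<in>E. Poly_Mapping.keys \<alpha>)"
  have S: "finite S" "\<one> \<in> S" "S \<subseteq> carrier G"
    using E by (auto simp: S_def group_ring_def)
  have keys: "Poly_Mapping.keys \<alpha> \<subseteq> S" if "\<alpha> \<in> E" for \<alpha> using that by (auto simp: S_def)
  define N where "N = nat \<lceil>12 * real (card B) * (real (card S))\<^sup>2 / \<theta>\<^sup>2\<rceil>"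
  have ev_J: "\<forall>\<^sub>F i in sequentially. J i \<in> Lambda_set G E \<eta>' (d i) (\<sigma> i)"
    using J E \<eta>'(1) by (simp add: Lambda_seq_def)
  have "\<forall>\<^sub>F i in sequentially. \<forall>x\<in>{(g, h) \<in> S \<times> S. g \<noteq> h}.
      real (card {j\<in>{1..d i}. \<sigma> i (fst x) j = \<sigma> i (snd x) j}) \<le> \<theta> * real (d i)"
  proof (intro eventually_ball_finite ballI)
    show "finite {(g, h) \<in> S \<times> S. g \<noteq> h}"
      by (rule finite_subset[of _ "S \<times> S"]) (use S in auto)
    fix x assume "x \<in> {(g, h) \<in> S \<times> S. g \<noteq> h}"
    then have "fst x \<in> carrier G" "snd x \<in> carrier G" "fst x \<noteq> snd x" using S by auto
    then show "\<forall>\<^sub>F i in sequentially.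
        real (card {j\<in>{1..d i}. \<sigma> i (fst x) j = \<sigma> i (snd x) j}) \<le> \<theta> * real (d i)"
      by (intro sofic_coincidence sof \<theta>)
  qed
  with ev_J have "\<forall>\<^sub>F i in sequentially. N \<le> d i \<longrightarrow> real (card (J i \<rightarrow>\<^sub>E B))
    \<le> 2 * real (card {c\<in>J i \<rightarrow>\<^sub>E B. \<forall>l\<in>B. {j \<in> J i. c j = l} \<in> Lambda_set G E \<eta> (d i) (\<sigma> i)})"
  proof eventually_elim
    case (elim i)
    show ?case
    proof
      assume "N \<le> d i"
      then have "12 * real (card B) * (real (card S))\<^sup>2 / \<theta>\<^sup>2 \<le> real (d i)"
        unfolding N_def by (simp add: nat_ceiling_le_eq)
      then have large: "12 * real (card B) * (real (card S))\<^sup>2 \<le> real (d i) * \<theta>\<^sup>2"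
        using \<theta>(1) by (simp add: divide_le_eq)
      have few: "real (card {j\<in>{1..d i}. \<sigma> i g j = \<sigma> i h j}) \<le> \<theta> * real (d i)"
        if "g \<in> S" "h \<in> S" "g \<noteq> h" for g h
        using elim(2)[rule_format, of "(g, h)"] that by simp
      have d0: "0 < d i" using sof by (simp add: sofic_approximation_def Suc_le_eq)
      show "real (card (J i \<rightarrow>\<^sub>E B))
        \<le> 2 * real (card {c\<in>J i \<rightarrow>\<^sub>E B. \<forall>l\<in>B. {j \<in> J i. c j = l} \<in> Lambda_set G E \<eta> (d i) (\<sigma> i)})"
        by (rule half_of_colourings[OF group_axioms d0 E(2) S(1,2) keys _ elim(1) M M1 \<open>0 < \<eta>\<close>
              less_imp_le[OF \<eta>'(1)] \<eta>'(2,3) \<theta> B few large])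
          (use S(3) sofic_permutes[OF sof] in auto)
    qed
  qed
  then show ?thesis by blast
qed

text \<open>Above a threshold degree, the count of good colourings feeds the shattering bound. Below
  it all colourings are good and I = J i works because \<beta> / 2 \<le> 1.\<close>

lemma eventually_shattered:
  fixes B :: "'y set"
  assumes sof: "sofic_approximation G d \<sigma>" and J: "J \<in> Lambda_seq G d \<sigma>"
    and E: "finite E" "E \<subseteq> group_ring G" and "0 < \<eta>" and B: "finite B" "B \<noteq> {}" and a: "0 < a"
    and \<beta>: "\<beta> = log 2 (real (card B) / (real (card B) - 1 / 2))"
  shows "\<forall>\<^sub>F i in sequentially. a < unif (d i) (J i) \<longrightarrow>
    (\<exists>I\<subseteq>J i. \<beta> / 2 * real (card (J i)) \<le> real (card I) \<and>
      shatters {c\<in>J i \<rightarrow>\<^sub>E B. \<forall>l\<in>B. {j \<in> J i. c j = l} \<in> Lambda_set G E \<eta> (d i) (\<sigma> i)} I B)"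
proof -
  have k1: "1 \<le> card B" using B by (simp add: Suc_leI card_gt_0_iff)
  note \<beta>01 = log_ratio_bounds[OF k1 \<beta>]
  obtain N where N: "\<forall>\<^sub>F i in sequentially. N \<le> d i \<longrightarrow> real (card (J i \<rightarrow>\<^sub>E B))
      \<le> 2 * real (card {c\<in>J i \<rightarrow>\<^sub>E B. \<forall>l\<in>B. {j \<in> J i. c j = l} \<in> Lambda_set G E \<eta> (d i) (\<sigma> i)})"
    using eventually_half_of_colourings[OF sof J E \<open>0 < \<eta>\<close> B(1)] by blast
  \<comment> \<open>The second entry gives \<beta> |J i| \<ge> \<beta> a d_i \<ge> 2, the size
    needed by the shattering bound.\<close>
  define N' where "N' = max N (nat \<lceil>2 / (\<beta> * a)\<rceil>)"
  show ?thesis using N Lambda_set_of_bounded_degree[OF sof, of N']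
  proof eventually_elim
    case (elim i)
    let ?good = "{c\<in>J i \<rightarrow>\<^sub>E B. \<forall>l\<in>B. {j \<in> J i. c j = l} \<in> Lambda_set G E \<eta> (d i) (\<sigma> i)}"
    have J_sub: "J i \<subseteq> {1..d i}" using J by (simp add: Lambda_seq_def)
    then have finJ: "finite (J i)" by (rule finite_subset) simp
    show ?case
    proof
      assume au: "a < unif (d i) (J i)"
      show "\<exists>I\<subseteq>J i. \<beta> / 2 * real (card (J i)) \<le> real (card I) \<and> shatters ?good I B"
      proof (cases "d i < N'")
        case True
        have "{j \<in> J i. c j = l} \<in> Lambda_set G E \<eta> (d i) (\<sigma> i)" for c :: "nat \<Rightarrow> 'y" and l
          using elim(2) True E(2) \<open>0 < \<eta>\<close> J_sub by (auto simp: subset_iff)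
        then have "shatters ?good (J i) B" by (auto simp: shatters_def)
        moreover have "\<beta> / 2 * real (card (J i)) \<le> 1 * real (card (J i))"
          using \<beta>01 by (intro mult_right_mono) auto
        ultimately show ?thesis by auto
      next
        case False
        have "2 / (\<beta> * a) \<le> real (d i)"
          using False unfolding N'_def by (simp add: nat_ceiling_le_eq not_less)
        then have "2 \<le> \<beta> * (a * real (d i))"
          using \<beta>01 a by (simp add: divide_le_eq mult_ac)
        also have "a * real (d i) \<le> real (card (J i))"
        proof -
          have "0 < real (d i)" using sof by (simp add: sofic_approximation_def Suc_le_eq)
          then show ?thesis using au unfolding unif_eq_card[OF J_sub] by (simp add: less_divide_eq)
        qed
        then have "\<beta> * (a * real (d i)) \<le> \<beta> * real (card (J i))"
          using \<beta>01 by (intro mult_left_mono) auto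
        finally have big: "2 \<le> \<beta> * real (card (J i))" .
        have half: "real (card (J i \<rightarrow>\<^sub>E B)) \<le> 2 * real (card ?good)"
          using elim(1) False by (simp add: N'_def)
        have "\<exists>I\<subseteq>J i. shatters ?good I B \<and> \<beta> / 2 * real (card (J i)) \<le> real (card I)"
          by (rule large_shattered_set[OF finJ B _ half \<beta> big]) blast
        then show ?thesis by blast
      qed
    qed
  qed
qed

end

section \<open>From shattered sets to independence sets\<close>

lemma unif_le_I_fin:
  assumes "independence_set X act q k x \<rho> F \<delta> n s \<epsilon> K J"
  shows "unif n J \<le> I_fin X act q k x \<rho> F \<delta> n s \<epsilon> K"
proof -
  have "finite {unif n J | J. independence_set X act q k x \<rho> F \<delta> n s \<epsilon> K J}"
  proof (rule finite_subset)
    show "{unif n J | J. independence_set X act q k x \<rho> F \<delta> n s \<epsilon> K J} \<subseteq> unif n ` Pow {1..n}"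
      by (auto simp: independence_set_def)
  qed simp
  then show ?thesis unfolding I_fin_def using assms by (intro Max_ge) auto
qed

theorem proposition3p5:
  fixes G :: "('g, 'm) monoid_scheme"
    and d :: "nat \<Rightarrow> nat"
    and \<sigma> :: "nat \<Rightarrow> 'g \<Rightarrow> nat \<Rightarrow> nat"
    and X :: "'x topology"
    and act :: "'g \<Rightarrow> 'x \<Rightarrow> 'x"
    and \<rho> :: "'x \<Rightarrow> 'x \<Rightarrow> real"
    and k :: nat
    and q :: ereal
  assumes "group G" and "countable (carrier G)"
    and "sofic_approximation G d \<sigma>"
    and "compact_space X" and "metrizable_space X"
    and "group_action G (topspace X) act"
    and "\<And>g. g \<in> carrier G \<Longrightarrow> homeomorphic_map X X (act g)"
    and "continuous_pseudometric X \<rho>" and "dynamically_generating G X act \<rho>"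
    and "1 \<le> k" and "1 \<le> q"
  shows "IE_Lambda G X act d \<sigma> \<rho> k q \<subseteq> IE G X act d \<sigma> \<rho> k q"
proof
  fix x assume x: "x \<in> IE_Lambda G X act d \<sigma> \<rho> k q"
  interpret group G by fact
  note sof = \<open>sofic_approximation G d \<sigma>\<close>
  have xX: "x \<in> {1..k} \<rightarrow>\<^sub>E topspace X" using x by (simp add: IE_Lambda_def)
  have act_in: "act g y \<in> topspace X" if "g \<in> carrier G" "y \<in> topspace X" for g y
    using homeomorphic_imp_surjective_map[OF assms(7)[OF that(1)]] that(2) by blast
  define \<beta> where "\<beta> = log 2 (real (card {1..k}) / (real (card {1..k}) - 1 / 2))"
  have "1 \<le> card {1..k}" using \<open>1 \<le> k\<close> by simp
  note \<beta>01 = log_ratio_bounds[OF this \<beta>_def]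
  \<comment> \<open>One number in two roles: the subset keeps at least the proportion r of J, and
    distances grow by at most 1/r; hence the tolerance r \<epsilon> below.\<close>
  define r where "r = \<beta> / 2"
  have r: "0 < r" "r \<le> 1" using \<beta>01 by (auto simp: r_def)
  have "0 < I_sofic G X act d \<sigma> q k x \<rho> \<epsilon> K" if \<epsilon>: "0 < \<epsilon>" and K: "finite K" "K \<subseteq> carrier G" for \<epsilon> K
  proof -
    have r\<epsilon>: "0 < r * \<epsilon>" using r \<epsilon> by simp
    then have "0 < I_Lambda G X act d \<sigma> q k x \<rho> (r * \<epsilon>) K"
      using x K by (simp add: IE_Lambda_def)
    \<comment> \<open>Choosing a before F and \<delta> makes r a a lower bound independent of them,
      which passes to the infimum.\<close>
    then obtain a where a: "0 < ereal a" "ereal a < I_Lambda G X act d \<sigma> q k x \<rho> (r * \<epsilon>) K"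
      using ereal_dense2 by blast
    have a0: "0 < a" using a(1) by simp
    have "ereal (r * a) \<le> limsup (\<lambda>i. ereal (I_fin X act q k x \<rho> F \<delta> (d i) (\<sigma> i) \<epsilon> K))"
      if F: "finite F" "F \<subseteq> carrier G" and \<delta>: "0 < \<delta>" for F \<delta>
    proof -
      have "I_Lambda G X act d \<sigma> q k x \<rho> (r * \<epsilon>) K
          \<le> (SUP (E, \<eta>) \<in> {E. finite E \<and> E \<subseteq> group_ring G} \<times> {0<..}.
              I_Lambda_fin G X act d \<sigma> q k x \<rho> F \<delta> E \<eta> (r * \<epsilon>) K)"
        unfolding I_Lambda_def by (rule INF_lower2[of "(F, \<delta>)"]) (use F \<delta> in auto)
      with a(2) have "ereal a < (SUP (E, \<eta>) \<in> {E. finite E \<and> E \<subseteq> group_ring G} \<times> {0<..}.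
          I_Lambda_fin G X act d \<sigma> q k x \<rho> F \<delta> E \<eta> (r * \<epsilon>) K)"
        by (rule less_le_trans)
      then obtain E \<eta> where E: "finite E" "E \<subseteq> group_ring G" and \<eta>: "0 < \<eta>"
        and I: "ereal a < I_Lambda_fin G X act d \<sigma> q k x \<rho> F \<delta> E \<eta> (r * \<epsilon>) K"
        unfolding less_SUP_iff by auto
      \<comment> \<open>Positivity of a excludes the default value 0 inserted into the
        supremum.\<close>
      from I a(1) obtain J where
        J: "Lambda_independence_seq G X act d \<sigma> q k x \<rho> F \<delta> E \<eta> (r * \<epsilon>) K J"
        and aJ: "ereal a < limsup (\<lambda>i. ereal (unif (d i) (J i)))"
        unfolding I_Lambda_fin_def less_Sup_iff by (auto dest: less_asym)
      have J\<Lambda>: "J \<in> Lambda_seq G d \<sigma>" using J by (simp add: Lambda_independence_seq_def)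
      have indep: "\<forall>\<^sub>F i in sequentially. \<forall>c \<in> J i \<rightarrow>\<^sub>E {1..k}.
          (\<forall>l\<in>{1..k}. {j \<in> J i. c j = l} \<in> Lambda_set G E \<eta> (d i) (\<sigma> i)) \<longrightarrow>
          (\<exists>\<phi>\<in>Microstates X act \<rho> F \<delta> (d i) (\<sigma> i).
             \<forall>g\<in>K. rho_q \<rho> q (J i) (\<lambda>j. act g (\<phi> j)) (\<lambda>j. act g (x (c j))) < r * \<epsilon>)"
        using J unfolding Lambda_independence_seq_def by blast
      have colours: "finite {1..k}" "{1..k} \<noteq> {}" using \<open>1 \<le> k\<close> by auto
      have ev: "\<forall>\<^sub>F i in sequentially. a < unif (d i) (J i) \<longrightarrow>
          r * a \<le> I_fin X act q k x \<rho> F \<delta> (d i) (\<sigma> i) \<epsilon> K"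
        using indep eventually_shattered[OF sof J\<Lambda> E \<eta> colours a0 \<beta>_def]
      proof eventually_elim
        case (elim i)
        show ?case
        proof
          assume au: "a < unif (d i) (J i)"
          have J_sub: "J i \<subseteq> {1..d i}" using J\<Lambda> by (simp add: Lambda_seq_def)
          then have finJ: "finite (J i)" by (rule finite_subset) simp
          obtain I where I: "I \<subseteq> J i" "r * real (card (J i)) \<le> real (card I)"
            and sh: "shatters {c\<in>J i \<rightarrow>\<^sub>E {1..k}. \<forall>l\<in>{1..k}.
              {j \<in> J i. c j = l} \<in> Lambda_set G E \<eta> (d i) (\<sigma> i)} I {1..k}"
            using elim(2) au unfolding r_def by blast
          have I_sub: "I \<subseteq> {1..d i}" using I(1) J_sub by blast
          have d0: "0 < real (d i)" using sof by (simp add: sofic_approximation_def Suc_le_eq)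
          have "0 < real (card (J i))"
            using au a0 d0 unfolding unif_eq_card[OF J_sub]
            by (cases "card (J i) = 0") auto
          then have "0 < r * real (card (J i))" using r(1) by simp
          then have "0 < card I" using I(2) by linarith
          then have I_ne: "I \<noteq> {}" by auto
          have "independence_set X act q k x \<rho> F \<delta> (d i) (\<sigma> i) \<epsilon> K I"
            unfolding independence_set_def
          proof (intro conjI ballI I_sub)
            fix c assume c: "c \<in> I \<rightarrow>\<^sub>E {1..k}"
            \<comment> \<open>The pattern on I extends to a colouring of J i with all classes in
              \<open>Lambda_set\<close>, the kind for which a microstate is guaranteed.\<close>
            from sh[unfolded shatters_def, rule_format, OF c] obtain c' where
              c'_good: "c' \<in> {c\<in>J i \<rightarrow>\<^sub>E {1..k}. \<forall>l\<in>{1..k}.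
                {j \<in> J i. c j = l} \<in> Lambda_set G E \<eta> (d i) (\<sigma> i)}"
              and c'_eq: "\<forall>j\<in>I. c' j = c j" ..
            from c'_good have c': "c' \<in> J i \<rightarrow>\<^sub>E {1..k}"
              "\<forall>l\<in>{1..k}. {j \<in> J i. c' j = l} \<in> Lambda_set G E \<eta> (d i) (\<sigma> i)"
              by simp_all
            from elim(1)[rule_format, OF c'(1)] c'(2) obtain \<phi> where
              \<phi>: "\<phi> \<in> Microstates X act \<rho> F \<delta> (d i) (\<sigma> i)"
              "\<forall>g\<in>K. rho_q \<rho> q (J i) (\<lambda>j. act g (\<phi> j)) (\<lambda>j. act g (x (c' j))) < r * \<epsilon>"
              by blast
            have "rho_q \<rho> q I (\<lambda>j. act g (\<phi> j)) (\<lambda>j. act g (x (c j))) < \<epsilon>" if g: "g \<in> K" for g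
            proof -
              have gG: "g \<in> carrier G" using K g by blast
              have "rho_q \<rho> q I (\<lambda>j. act g (\<phi> j)) (\<lambda>j. act g (x (c j)))
                  = rho_q \<rho> q I (\<lambda>j. act g (\<phi> j)) (\<lambda>j. act g (x (c' j)))"
                using c'_eq unfolding rho_q_def by (simp cong: image_cong sum.cong)
              also have "\<dots> \<le> rho_q \<rho> q (J i) (\<lambda>j. act g (\<phi> j)) (\<lambda>j. act g (x (c' j))) / r"
              proof (rule rho_q_subset_le[OF finJ I(1) I_ne r I(2) \<open>1 \<le> q\<close>])
                fix j assume j: "j \<in> J i"
                have "\<phi> j \<in> topspace X" using \<phi>(1) j J_sub by (auto simp: Microstates_def)
                moreover have "x (c' j) \<in> topspace X" using xX c'(1) j by (meson PiE_mem)
                ultimately show "0 \<le> \<rho> (act g (\<phi> j)) (act g (x (c' j)))"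
                  using act_in[OF gG] \<open>continuous_pseudometric X \<rho>\<close>
                  unfolding continuous_pseudometric_def by blast
              qed
              also have "\<dots> < \<epsilon>" using bspec[OF \<phi>(2) g] r by (simp add: divide_less_eq mult.commute)
              finally show ?thesis .
            qed
            then show "\<exists>\<phi>\<in>Microstates X act \<rho> F \<delta> (d i) (\<sigma> i).
                \<forall>g\<in>K. rho_q \<rho> q I (\<lambda>j. act g (\<phi> j)) (\<lambda>j. act g (x (c j))) < \<epsilon>"
              using \<phi>(1) by blast
          qed
          then have "unif (d i) I \<le> I_fin X act q k x \<rho> F \<delta> (d i) (\<sigma> i) \<epsilon> K"
            by (rule unif_le_I_fin)
          moreover have "r * unif (d i) (J i) \<le> unif (d i) I"
            using I(2) d0 unfolding unif_eq_card[OF J_sub] unif_eq_card[OF I_sub]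
            by (simp add: divide_right_mono)
          moreover have "r * a \<le> r * unif (d i) (J i)" using au r by simp
          ultimately show "r * a \<le> I_fin X act q k x \<rho> F \<delta> (d i) (\<sigma> i) \<epsilon> K" by linarith
        qed
      qed
      show ?thesis
      \<comment> \<open>A limsup below r a would put \<open>I_fin\<close> eventually below r a,
        hence by \<open>ev\<close> the density of J i eventually at most a, against
        \<open>aJ\<close>.\<close>
      proof (rule ccontr)
        assume "\<not> ?thesis"
        then have "\<forall>\<^sub>F i in sequentially.
            ereal (I_fin X act q k x \<rho> F \<delta> (d i) (\<sigma> i) \<epsilon> K) < ereal (r * a)"
          by (intro Limsup_lessD) (simp add: not_le)
        with ev have "\<forall>\<^sub>F i in sequentially. ereal (unif (d i) (J i)) \<le> ereal a"
          by eventually_elim auto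
        then have "limsup (\<lambda>i. ereal (unif (d i) (J i))) \<le> ereal a" by (rule Limsup_bounded)
        with aJ show False by (simp add: not_le)
      qed
    qed
    then have "ereal (r * a) \<le> I_sofic G X act d \<sigma> q k x \<rho> \<epsilon> K"
      unfolding I_sofic_def by (intro INF_greatest) auto
    moreover have "0 < ereal (r * a)" using r a0 by simp
    ultimately show ?thesis by (rule less_le_trans[rotated])
  qed
  then show "x \<in> IE G X act d \<sigma> \<rho> k q" using xX by (simp add: IE_def)
qed

end
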